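(* Let $\frac{d}{dt}x=f(x,u)$ be a $G$-invariant system with $G$-equivariant output $y=h(x,u)$, and let $\frac{d}{dt}\hat x=F(\hat x,u,y)$ be a $G$-invariant pre-observer. Then the dynamics of the invariant state-error $$\eta(x,\hat x)=\varphi_{\gamma(x)}(\hat x)-\varphi_{\gamma(x)}(x)$$ depends only on $\eta$ and on scalar invariants depending on $x$ and $u$: along solutions of $\frac{d}{dt}x=f(x,u)$, $\frac{d}{dt}\hat x=F(\hat x,u,h(x,u))$, $$\frac{d}{dt}\eta=\Upsilon\bigl(\eta,I(x,u)\bigr)$$ for some smooth function $\Upsilon$, where $I(x,u)\in\mathbb{R}^{n+m-r}$ is a full-rank invariant function (a complete set of $n+m-r$ independent scalar invariants of $(x,u)$).
   Context: Setting. $\mathcal X\subset\mathbb{R}^n$, $\mathcal U\subset\mathbb{R}^m$, $\mathcal Y\subset\mathbb{R}^p$ are open, $p\le n$, and $f:\mathcal X\times\mathcal U\to\mathbb{R}^n$, $h:\mathcal X\times\mathcal U\to\mathcal Y$ are smooth. $G$ is a Lie group of dimension $r\le n$ with identity $e$. A (local) transformation group $(\phi_g)_{g\in G}$ on an open set $\Sigma$ is a smooth map $(g,\xi)\mapsto\phi_g(\xi)\in\Sigma$ with $\phi_e(\xi)=\xi$ and $\phi_{g_2}(\phi_{g_1}(\xi))=\phi_{g_2g_1}(\xi)$; it is local if $\phi_g(\xi)$ is defined only for $g$ near $e$ and the composition law is imposed only where it makes sense. $G$ acts by local transformation groups $\varphi_g$ on $\mathcal X$, $\psi_g$ on $\mathcal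 U$, and $\varrho_g$ on $\mathcal Y$. Standing assumption: for each $x$ the map $g\mapsto\varphi_g(x)$ has full rank $r$. Local convention: all statements are local. "For all $g$" means for all $g$ sufficiently near $e$, and "for all" points means for all generic points; all functions (such as $\gamma$, $I$, $\Upsilon$) are only required to exist locally. Definitions. - The system is $G$-invariant if $f(\varphi_g(x),\psi_g(u))=D\varphi_g(x)\cdot f(x,u)$ for all $g,x,u$; the output is $G$-equivariant if $h(\varphi_g(x),\psi_g(u))=\varrho_g(h(x,u))$ for all $g,x,u$. - $\frac{d}{dt}\hat x=F(\hat x,u,y)$ ($F$ smooth) is a pre-observer if $F(x,u,h(x,u))=f(x,u)$ for all $x,u$; it is $G$-invariant if $F(\varphi_g(\hat x),\psi_g(u),\varrho_g(y))=D\varphi_g(\hat x)\cdot F(\hat x,u,y)$ for all $g,\hat x,u,y$. - Moving frame $\gamma$: since the action on $\mathcal X$ has full rank, split $\varphi_g=(\varphi_g^a,\varphi_g^b)$ into $r$ and $n-r$ components so that $\varphi_g^a(x)$ is locally invertible with respect to $g$. Fix a constant $c$ in the range of $\varphi^a$; the normalization equation $\varphi_g^a(x)=c$ has a unique local solution $g=\gamma(x)$, with $\gamma:\mathcal X\to G$ smooth. - A function $I(x,u)$ is invariant if $I(\varphi_g(x),\psi_g(u))=I(x,u)$ for all $g,x,u$; full-rank means that its Jacobian has rank $n+m-r$. Such an $I$ is given by $I(x,u)=\bigl(\varphi^b_{\gamma(x)}(x),\psi_{\gamma(x)}(u)\bigr)$. *)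

theory Defs
  imports "HOL-Analysis.Analysis"
begin

subsection \<open>Smooth maps between open subsets of normed spaces\<close>

text \<open>Continuous differentiability of order \<open>k\<close> via iterated directional derivatives; on an open
  subset of a finite-dimensional space this is the usual class \<open>C\<^sup>k\<close>.
  It is only meant to be used for open \<open>S\<close>.\<close>

primrec Ck_on :: "nat \<Rightarrow> 'a::real_normed_vector set \<Rightarrow> ('a \<Rightarrow> 'b::real_normed_vector) \<Rightarrow> bool" where
  "Ck_on 0 S f \<longleftrightarrow> continuous_on S f"
| "Ck_on (Suc k) S f \<longleftrightarrow> (\<forall>x\<in>S. f differentiable (at x)) \<and>
     (\<forall>v. Ck_on k S (\<lambda>x. frechet_derivative f (at x) v))"

definition smooth_on :: "'a::real_normed_vector set \<Rightarrow> ('a \<Rightarrow> 'b::real_normed_vector) \<Rightarrow> bool" where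
  "smooth_on S f \<longleftrightarrow> (\<forall>k. Ck_on k S f)"

definition rank_at :: "('a::real_normed_vector \<Rightarrow> 'b::euclidean_space) \<Rightarrow> 'a \<Rightarrow> nat" where
  "rank_at f x = dim (range (frechet_derivative f (at x)))"

text \<open>Local invertibility in the smooth category: a smooth map with a smooth local inverse.\<close>

definition locally_invertible_at ::
  "('a::real_normed_vector \<Rightarrow> 'b::real_normed_vector) \<Rightarrow> 'a \<Rightarrow> bool" where
  "locally_invertible_at f a \<longleftrightarrow>
     (\<exists>P Q q. open P \<and> a \<in> P \<and> open Q \<and> homeomorphism P Q f q \<and> smooth_on P f \<and> smooth_on Q q)"


subsection \<open>Lie groups\<close>

text \<open>The group is a whole type with its topology, the smooth structure is an atlas of
  charts \<open>(U, \<kappa>)\<close> with values in \<open>\<real>\<^sup>r\<close>, \<open>r = CARD('r)\<close>. The local parametrisation inverse to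
  \<open>\<kappa>\<close> is \<open>inv_into U \<kappa>\<close>.\<close>

definition is_chart :: "'g::topological_space set \<times> ('g \<Rightarrow> real^'r) \<Rightarrow> bool" where
  "is_chart = (\<lambda>(U, \<kappa>). open U \<and> open (\<kappa> ` U) \<and> homeomorphism U (\<kappa> ` U) \<kappa> (inv_into U \<kappa>))"

locale lie_group = group gmul e ginv
  for gmul :: "'g::{t2_space, second_countable_topology} \<Rightarrow> 'g \<Rightarrow> 'g" and e :: 'g and ginv :: "'g \<Rightarrow> 'g" +
  fixes atlas :: "('g set \<times> ('g \<Rightarrow> real^'r)) set"
  assumes charts: "\<And>K. K \<in> atlas \<Longrightarrow> is_chart K"
    and charts_cover: "(\<Union>(U, \<kappa>)\<in>atlas. U) = UNIV"
    and charts_compatible: "\<And>U \<kappa> V \<mu>. \<lbrakk>(U, \<kappa>) \<in> atlas; (V, \<mu>) \<in> atlas\<rbrakk> \<Longrightarrow>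
      smooth_on (\<kappa> ` (U \<inter> V)) (\<lambda>a. \<mu> (inv_into U \<kappa> a))"
    and mult_continuous: "continuous_on UNIV (\<lambda>(g, k). gmul g k)"
    and mult_smooth: "\<And>U \<kappa> V \<mu> W \<nu>. \<lbrakk>(U, \<kappa>) \<in> atlas; (V, \<mu>) \<in> atlas; (W, \<nu>) \<in> atlas\<rbrakk> \<Longrightarrow>
      smooth_on {(a, b). a \<in> \<kappa> ` U \<and> b \<in> \<mu> ` V \<and> gmul (inv_into U \<kappa> a) (inv_into V \<mu> b) \<in> W}
        (\<lambda>(a, b). \<nu> (gmul (inv_into U \<kappa> a) (inv_into V \<mu> b)))"
    and inv_continuous: "continuous_on UNIV ginv"
    and inv_smooth: "\<And>U \<kappa> V \<mu>. \<lbrakk>(U, \<kappa>) \<in> atlas; (V, \<mu>) \<in> atlas\<rbrakk> \<Longrightarrow>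
      smooth_on {a \<in> \<kappa> ` U. ginv (inv_into U \<kappa> a) \<in> V} (\<lambda>a. \<mu> (ginv (inv_into U \<kappa> a)))"

definition smooth_on_group_times ::
  "('g::topological_space set \<times> ('g \<Rightarrow> real^'r)) set \<Rightarrow> ('g \<times> 'a::real_normed_vector) set
    \<Rightarrow> ('g \<Rightarrow> 'a \<Rightarrow> 'b::real_normed_vector) \<Rightarrow> bool" where
  "smooth_on_group_times atlas D \<phi> \<longleftrightarrow>
     (\<forall>(U, \<kappa>)\<in>atlas. smooth_on {(a, x). a \<in> \<kappa> ` U \<and> (inv_into U \<kappa> a, x) \<in> D}
        (\<lambda>(a, x). \<phi> (inv_into U \<kappa> a) x))"

definition smooth_into_group ::
  "('g::topological_space set \<times> ('g \<Rightarrow> real^'r)) set \<Rightarrow> 'a::real_normed_vector set \<Rightarrow> ('a \<Rightarrow> 'g) \<Rightarrow> bool"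
  where
  "smooth_into_group atlas W \<gamma> \<longleftrightarrow> continuous_on W \<gamma> \<and>
     (\<forall>(U, \<kappa>)\<in>atlas. smooth_on {x \<in> W. \<gamma> x \<in> U} (\<lambda>x. \<kappa> (\<gamma> x)))"


subsection \<open>Local transformation groups\<close>

text \<open>\<open>\<phi> g \<xi>\<close> is meaningful for \<open>(g, \<xi>)\<close> in an open domain \<open>D\<close> containing \<open>{e} \<times> \<Sigma>\<close>; a global action
  is the case \<open>D = UNIV \<times> \<Sigma>\<close>.\<close>

definition local_transformation_group ::
  "('g::topological_space \<Rightarrow> 'g \<Rightarrow> 'g) \<Rightarrow> 'g \<Rightarrow> ('g set \<times> ('g \<Rightarrow> real^'r)) set
    \<Rightarrow> 'a::real_normed_vector set \<Rightarrow> ('g \<Rightarrow> 'a \<Rightarrow> 'a) \<Rightarrow> bool" where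
  "local_transformation_group gmul e atlas \<Sigma> \<phi> \<longleftrightarrow>
     (\<exists>D. open D \<and> {e} \<times> \<Sigma> \<subseteq> D \<and> D \<subseteq> UNIV \<times> \<Sigma> \<and>
        (\<forall>(g, \<xi>)\<in>D. \<phi> g \<xi> \<in> \<Sigma>) \<and>
        smooth_on_group_times atlas D \<phi> \<and>
        (\<forall>\<xi>\<in>\<Sigma>. \<phi> e \<xi> = \<xi>) \<and>
        (\<forall>g1 g2 \<xi>. (g1, \<xi>) \<in> D \<and> (g2, \<phi> g1 \<xi>) \<in> D \<and> (gmul g2 g1, \<xi>) \<in> D \<longrightarrow>
           \<phi> g2 (\<phi> g1 \<xi>) = \<phi> (gmul g2 g1) \<xi>))"

text \<open>``For all \<open>g\<close>'' means for all \<open>g\<close> sufficiently near \<open>e\<close>. The neighbourhood of \<open>e\<close> may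
  vary with the point, but is uniform near each point.\<close>

definition full_rank_action ::
  "'g::topological_space \<Rightarrow> ('g set \<times> ('g \<Rightarrow> real^'r)) set
    \<Rightarrow> (real^'n) set \<Rightarrow> ('g \<Rightarrow> real^'n \<Rightarrow> real^'n) \<Rightarrow> bool" where
  "full_rank_action e atlas X \<phi> \<longleftrightarrow>
     (\<forall>x\<in>X. \<forall>\<^sub>F g in nhds e. \<forall>(U, \<kappa>)\<in>atlas. g \<in> U \<longrightarrow>
        rank_at (\<lambda>a. \<phi> (inv_into U \<kappa> a) x) (\<kappa> g) = CARD('r))"


subsection \<open>Invariant systems and pre-observers\<close>

definition invariant_system ::
  "'g::topological_space \<Rightarrow> ('g \<Rightarrow> real^'n \<Rightarrow> real^'n) \<Rightarrow> ('g \<Rightarrow> real^'m \<Rightarrow> real^'m)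
    \<Rightarrow> (real^'n) set \<Rightarrow> (real^'m) set \<Rightarrow> (real^'n \<Rightarrow> real^'m \<Rightarrow> real^'n) \<Rightarrow> bool" where
  "invariant_system e \<phi> \<psi> X U f \<longleftrightarrow>
     (\<forall>x0\<in>X. \<forall>u0\<in>U. \<forall>\<^sub>F (g, x, u) in nhds (e, x0, u0).
        f (\<phi> g x) (\<psi> g u) = frechet_derivative (\<phi> g) (at x) (f x u))"

definition equivariant_output ::
  "'g::topological_space \<Rightarrow> ('g \<Rightarrow> real^'n \<Rightarrow> real^'n) \<Rightarrow> ('g \<Rightarrow> real^'m \<Rightarrow> real^'m)
    \<Rightarrow> ('g \<Rightarrow> real^'p \<Rightarrow> real^'p) \<Rightarrow> (real^'n) set \<Rightarrow> (real^'m) set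
    \<Rightarrow> (real^'n \<Rightarrow> real^'m \<Rightarrow> real^'p) \<Rightarrow> bool" where
  "equivariant_output e \<phi> \<psi> \<rho> X U h \<longleftrightarrow>
     (\<forall>x0\<in>X. \<forall>u0\<in>U. \<forall>\<^sub>F (g, x, u) in nhds (e, x0, u0).
        h (\<phi> g x) (\<psi> g u) = \<rho> g (h x u))"

definition pre_observer ::
  "(real^'n) set \<Rightarrow> (real^'m) set \<Rightarrow> (real^'p) set \<Rightarrow> (real^'n \<Rightarrow> real^'m \<Rightarrow> real^'n)
    \<Rightarrow> (real^'n \<Rightarrow> real^'m \<Rightarrow> real^'p) \<Rightarrow> (real^'n \<Rightarrow> real^'m \<Rightarrow> real^'p \<Rightarrow> real^'n) \<Rightarrow> bool" where
  "pre_observer X U Y f h F \<longleftrightarrow>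
     smooth_on (X \<times> U \<times> Y) (\<lambda>(x, u, y). F x u y) \<and>
     (\<forall>x\<in>X. \<forall>u\<in>U. F x u (h x u) = f x u)"

definition invariant_pre_observer ::
  "'g::topological_space \<Rightarrow> ('g \<Rightarrow> real^'n \<Rightarrow> real^'n) \<Rightarrow> ('g \<Rightarrow> real^'m \<Rightarrow> real^'m)
    \<Rightarrow> ('g \<Rightarrow> real^'p \<Rightarrow> real^'p) \<Rightarrow> (real^'n) set \<Rightarrow> (real^'m) set \<Rightarrow> (real^'p) set
    \<Rightarrow> (real^'n \<Rightarrow> real^'m \<Rightarrow> real^'n) \<Rightarrow> (real^'n \<Rightarrow> real^'m \<Rightarrow> real^'p)
    \<Rightarrow> (real^'n \<Rightarrow> real^'m \<Rightarrow> real^'p \<Rightarrow> real^'n) \<Rightarrow> bool" where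
  "invariant_pre_observer e \<phi> \<psi> \<rho> X U Y f h F \<longleftrightarrow> pre_observer X U Y f h F \<and>
     (\<forall>x0\<in>X. \<forall>u0\<in>U. \<forall>y0\<in>Y. \<forall>\<^sub>F (g, x, u, y) in nhds (e, x0, u0, y0).
        F (\<phi> g x) (\<psi> g u) (\<rho> g y) = frechet_derivative (\<phi> g) (at x) (F x u y))"


subsection \<open>Moving frame, invariants and invariant state-error\<close>

text \<open>A splitting \<open>\<phi>\<^sub>g = (\<phi>\<^sub>g\<^sup>a, \<phi>\<^sub>g\<^sup>b)\<close> is a choice of \<open>r\<close> of the \<open>n\<close> components, given by an injection
  \<open>a :: 'r \<Rightarrow> 'n\<close>; the \<open>b\<close>-components are those with index outside \<open>range a\<close>.\<close>

definition comps :: "('r \<Rightarrow> 'n) \<Rightarrow> real^'n \<Rightarrow> real^'r" where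
  "comps a x = (\<chi> i. x $ a i)"

definition admissible_splitting ::
  "'g::topological_space \<Rightarrow> ('g set \<times> ('g \<Rightarrow> real^'r)) set \<Rightarrow> ('g \<Rightarrow> real^'n \<Rightarrow> real^'n)
    \<Rightarrow> ('r \<Rightarrow> 'n) \<Rightarrow> real^'n \<Rightarrow> bool" where
  "admissible_splitting e atlas \<phi> a x0 \<longleftrightarrow> inj a \<and>
     (\<forall>(U, \<kappa>)\<in>atlas. e \<in> U \<longrightarrow>
        locally_invertible_at (\<lambda>b. comps a (\<phi> (inv_into U \<kappa> b) x0)) (\<kappa> e))"

text \<open>\<open>M\<close> is the region of the group in which the solution of the normalization equation is unique.\<close>

definition moving_frame_on ::
  "('g::topological_space set \<times> ('g \<Rightarrow> real^'r)) set \<Rightarrow> ('g \<Rightarrow> real^'n \<Rightarrow> real^'n)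
    \<Rightarrow> ('r \<Rightarrow> 'n) \<Rightarrow> real^'r \<Rightarrow> (real^'n) set \<Rightarrow> (real^'n \<Rightarrow> 'g) \<Rightarrow> bool" where
  "moving_frame_on atlas \<phi> a c W \<gamma> \<longleftrightarrow> open W \<and> smooth_into_group atlas W \<gamma> \<and>
     (\<exists>M. open M \<and> \<gamma> ` W \<subseteq> M \<and> (\<forall>x\<in>W. \<forall>g\<in>M. comps a (\<phi> g x) = c \<longleftrightarrow> g = \<gamma> x))"

definition full_rank_invariant_on ::
  "'g::topological_space \<Rightarrow> ('g set \<times> ('g \<Rightarrow> real^'r)) set
    \<Rightarrow> ('g \<Rightarrow> real^'n \<Rightarrow> real^'n) \<Rightarrow> ('g \<Rightarrow> real^'m \<Rightarrow> real^'m)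
    \<Rightarrow> ((real^'n) \<times> (real^'m)) set \<Rightarrow> ((real^'n) \<times> (real^'m) \<Rightarrow> real^'k) \<Rightarrow> bool" where
  "full_rank_invariant_on e atlas \<phi> \<psi> V I \<longleftrightarrow> open V \<and> smooth_on V I \<and>
     (\<forall>(x0, u0)\<in>V. \<forall>\<^sub>F (g, x, u) in nhds (e, x0, u0). I (\<phi> g x, \<psi> g u) = I (x, u)) \<and>
     (\<forall>z\<in>V. rank_at I z = CARD('n) + CARD('m) - CARD('r))"

text \<open>The invariant \<open>(x, u) \<mapsto> (\<phi>\<^sup>b\<^bsub>\<gamma>(x)\<^esub>(x), \<psi>\<^bsub>\<gamma>(x)\<^esub>(u))\<close> as a vector indexed by \<open>'k\<close>, the type \<open>'k\<close> being
  identified by \<open>\<beta>\<close> with the disjoint sum of the \<open>b\<close>-indices and the input indices. The case of no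
  \<open>b\<close>-component, \<open>r = n\<close>, is thereby covered.\<close>

definition frame_invariant ::
  "('g \<Rightarrow> real^'n \<Rightarrow> real^'n) \<Rightarrow> ('g \<Rightarrow> real^'m \<Rightarrow> real^'m) \<Rightarrow> (real^'n \<Rightarrow> 'g)
    \<Rightarrow> ('k \<Rightarrow> 'n + 'm) \<Rightarrow> (real^'n) \<times> (real^'m) \<Rightarrow> real^'k" where
  "frame_invariant \<phi> \<psi> \<gamma> \<beta> =
     (\<lambda>(x, u). \<chi> k. case \<beta> k of Inl i \<Rightarrow> \<phi> (\<gamma> x) x $ i | Inr j \<Rightarrow> \<psi> (\<gamma> x) u $ j)"

definition state_error ::
  "('g \<Rightarrow> real^'n \<Rightarrow> real^'n) \<Rightarrow> (real^'n \<Rightarrow> 'g) \<Rightarrow> real^'n \<Rightarrow> real^'n \<Rightarrow> real^'n" where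
  "state_error \<phi> \<gamma> x xh = \<phi> (\<gamma> x) xh - \<phi> (\<gamma> x) x"

text \<open>Solutions on the time interval \<open>J\<close> of the system coupled with the pre-observer, staying in
  the region \<open>\<Omega>\<close>; the input signal \<open>u\<close> is arbitrary.\<close>

definition solution_in ::
  "(real^'n \<Rightarrow> real^'m \<Rightarrow> real^'n) \<Rightarrow> (real^'n \<Rightarrow> real^'m \<Rightarrow> real^'p)
    \<Rightarrow> (real^'n \<Rightarrow> real^'m \<Rightarrow> real^'p \<Rightarrow> real^'n) \<Rightarrow> ((real^'n) \<times> (real^'n) \<times> (real^'m)) set \<Rightarrow> real set
    \<Rightarrow> (real \<Rightarrow> real^'n) \<Rightarrow> (real \<Rightarrow> real^'n) \<Rightarrow> (real \<Rightarrow> real^'m) \<Rightarrow> bool" where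
  "solution_in f h F \<Omega> J x xh u \<longleftrightarrow> is_interval J \<and>
     (\<forall>t\<in>J. (x t, xh t, u t) \<in> \<Omega> \<and>
        (x has_vector_derivative f (x t) (u t)) (at t within J) \<and>
        (xh has_vector_derivative F (xh t) (u t) (h (x t) (u t))) (at t within J))"

text \<open>Near \<open>(x0, xh0, u0)\<close> the error obeys \<open>d\<eta>/dt = \<Upsilon>(\<eta>, I(x,u))\<close> with one smooth \<open>\<Upsilon>\<close>, defined on
  a neighbourhood \<open>Q\<close> of the corresponding value of \<open>(\<eta>, I)\<close>.\<close>

definition autonomous_error_dynamics ::
  "(real^'n \<Rightarrow> real^'m \<Rightarrow> real^'n) \<Rightarrow> (real^'n \<Rightarrow> real^'m \<Rightarrow> real^'p)
    \<Rightarrow> (real^'n \<Rightarrow> real^'m \<Rightarrow> real^'p \<Rightarrow> real^'n) \<Rightarrow> (real^'n \<Rightarrow> real^'n \<Rightarrow> real^'n)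
    \<Rightarrow> ((real^'n) \<times> (real^'m) \<Rightarrow> real^'k) \<Rightarrow> real^'n \<Rightarrow> real^'n \<Rightarrow> real^'m \<Rightarrow> bool" where
  "autonomous_error_dynamics f h F \<eta> I x0 xh0 u0 \<longleftrightarrow>
     (\<exists>(\<Upsilon> :: (real^'n) \<times> (real^'k) \<Rightarrow> real^'n) Q \<Omega>. open Q \<and> smooth_on Q \<Upsilon> \<and> open \<Omega> \<and> (x0, xh0, u0) \<in> \<Omega> \<and>
        (\<forall>(x, xh, u)\<in>\<Omega>. (\<eta> x xh, I (x, u)) \<in> Q) \<and>
        (\<forall>J x xh u. solution_in f h F \<Omega> J x xh u \<longrightarrow>
           (\<forall>t\<in>J. ((\<lambda>s. \<eta> (x s) (xh s)) has_vector_derivative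
                      \<Upsilon> (\<eta> (x t) (xh t), I (x t, u t))) (at t within J))))"

end

theory Submission
  imports Defs
begin

text \<open>Let \<open>g0 = \<gamma>(x0)\<close> and \<open>s(x) = g0\<^sup>-\<^sup>1 \<gamma>(x)\<close>, which is close to \<open>e\<close> near \<open>x0\<close>. Since
  \<open>\<gamma>(\<phi>\<^sub>s(x)) = \<gamma>(x) s\<^sup>-\<^sup>1\<close>, the error \<open>\<eta>\<close> is invariant; differentiating this invariance and using
  the equivariance of \<open>f\<close>, \<open>F\<close> and \<open>h\<close>, the rate \<open>G(x, \<xi>, u) = D\<eta>(x, \<xi>) (f(x, u), F(\<xi>, u, h(x, u)))\<close>
  is invariant too. Hence \<open>G(x, \<xi>, u) = G(\<phi>\<^sub>s(x), \<phi>\<^sub>s(\<xi>), \<psi>\<^sub>s(u))\<close> with \<open>s = s(x)\<close>, and the arguments on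
  the right are functions of \<open>\<eta>\<close> and of the frame invariant \<open>J\<close>: the state \<open>\<phi>\<^bsub>\<gamma>(x)\<^esub>(x)\<close> has the
  components \<open>c\<close> and \<open>\<phi>\<^sup>b\<^bsub>\<gamma>(x)\<^esub>(x)\<close>, and \<open>\<phi>\<^bsub>\<gamma>(x)\<^esub>(\<xi>)\<close> is the sum of it and \<open>\<eta>\<close>.

  The same normalization writes any invariant as \<open>I = A \<circ> J\<close>. If \<open>I\<close> has full rank, then \<open>DA\<close> is
  invertible and the inverse function theorem gives \<open>J = \<Theta> \<circ> I\<close> with \<open>\<Theta>\<close> smooth. The rank of \<open>J\<close>
  is full because \<open>(z, w) \<mapsto> (\<phi>\<^bsub>g0\<^sup>-\<^sup>1\<^esub>(c, z), \<psi>\<^bsub>g0\<^sup>-\<^sup>1\<^esub>(w))\<close> is a local right inverse of it.\<close>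

subsection \<open>Calculus of smooth maps\<close>

text \<open>As \<open>S\<close> is open, functions that agree on it have the same derivative at each
  of its points, so the agreement passes to the derivatives and the induction on the order goes
  through.\<close>

lemma Ck_on_cong:
  assumes "open S" "\<And>x. x \<in> S \<Longrightarrow> f x = g x" "Ck_on k S f"
  shows "Ck_on k S g"
  using assms(2,3)
proof (induction k arbitrary: f g)
  case 0
  then show ?case by (simp cong: continuous_on_cong)
next
  case (Suc k)
  have D: "(g has_derivative frechet_derivative f (at x)) (at x)" if "x \<in> S" for x
    using Suc.prems that assms(1) frechet_derivative_works
    by (metis Ck_on.simps(2) has_derivative_transform_within_open)
  then have "frechet_derivative f (at x) = frechet_derivative g (at x)" if "x \<in> S" for x
    using that frechet_derivative_at by blast
  then have "Ck_on k S (\<lambda>x. frechet_derivative g (at x) v)" for v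
    using Suc.IH[of "\<lambda>x. frechet_derivative f (at x) v"] Suc.prems(2) by simp
  then show ?case
    using D by (auto simp: differentiable_def)
qed

text \<open>Lets an explicit derivative stand in for \<open>frechet_derivative\<close>, so that the
  inductions on the order below can feed in the usual differentiation rules.\<close>

lemma Ck_on_Suc_intro:
  assumes "open S" "\<And>x. x \<in> S \<Longrightarrow> (f has_derivative f' x) (at x)" "\<And>v. Ck_on k S (\<lambda>x. f' x v)"
  shows "Ck_on (Suc k) S f"
proof -
  have "f' x v = frechet_derivative f (at x) v" if "x \<in> S" for x v
    using assms(2)[OF that] frechet_derivative_at by metis
  then have "Ck_on k S (\<lambda>x. frechet_derivative f (at x) v)" for v
    using Ck_on_cong[OF assms(1) _ assms(3)[of v]] by simp
  then show ?thesis
    using assms(2) by (auto simp: differentiable_def)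
qed

lemma Ck_on_derivative:
  "Ck_on (Suc k) S f \<Longrightarrow> x \<in> S \<Longrightarrow> (f has_derivative frechet_derivative f (at x)) (at x)"
  using frechet_derivative_works by auto

lemma Ck_on_Suc: "Ck_on (Suc k) S f \<Longrightarrow> Ck_on k S f"
proof (induction k arbitrary: f)
  case 0
  then show ?case
    by (auto simp: continuous_on_eq_continuous_within intro!: differentiable_imp_continuous_within
        intro: differentiable_at_withinI)
next
  case (Suc k)
  then show ?case by (meson Ck_on.simps(2))
qed

lemma Ck_on_subset: "Ck_on k S f \<Longrightarrow> T \<subseteq> S \<Longrightarrow> Ck_on k T f"
  by (induction k arbitrary: f) (auto intro: continuous_on_subset)

text \<open>Every condition in the definition concerns a single point and its neighbourhood. Maps
  that pass through the group can therefore be checked one chart at a time.\<close>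

lemma Ck_on_local:
  assumes "\<And>x. x \<in> S \<Longrightarrow> \<exists>T. open T \<and> x \<in> T \<and> Ck_on k T f"
  shows "Ck_on k S f"
  using assms
proof (induction k arbitrary: f)
  case 0
  then show ?case
    by (metis Ck_on.simps(1) continuous_at_imp_continuous_on continuous_on_eq_continuous_at)
next
  case (Suc k)
  then show ?case by (metis Ck_on.simps(2))
qed

lemma Ck_on_const: "Ck_on k S (\<lambda>x. c)"
  by (induction k arbitrary: c) (auto simp: frechet_derivative_const)

lemma Ck_on_bounded_linear_compose:
  assumes "open S" "bounded_linear L" "Ck_on k S f"
  shows "Ck_on k S (\<lambda>x. L (f x))"
  using assms(3)
proof (induction k arbitrary: f)
  case 0
  then show ?case
    using assms(2) by (simp add: bounded_linear.continuous_on)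
next
  case (Suc k)
  show ?case
  proof (rule Ck_on_Suc_intro[OF assms(1)])
    show "((\<lambda>x. L (f x)) has_derivative (\<lambda>v. L (frechet_derivative f (at x) v))) (at x)"
      if "x \<in> S" for x
      using bounded_linear.has_derivative[OF assms(2) Ck_on_derivative[OF Suc.prems that]] .
  qed (use Suc in auto)
qed

lemma Ck_on_id: "open S \<Longrightarrow> Ck_on k S (\<lambda>x. x)"
  by (cases k) (auto simp: Ck_on_const)

lemma Ck_on_bounded_linear: "open S \<Longrightarrow> bounded_linear L \<Longrightarrow> Ck_on k S L"
  using Ck_on_bounded_linear_compose[OF _ _ Ck_on_id] .

lemma Ck_on_add:
  assumes "open S" "Ck_on k S f" "Ck_on k S g"
  shows "Ck_on k S (\<lambda>x. f x + g x)"
  using assms(2,3)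
proof (induction k arbitrary: f g)
  case 0
  then show ?case by (simp add: continuous_on_add)
next
  case (Suc k)
  show ?case
  proof (rule Ck_on_Suc_intro[OF assms(1)])
    show "((\<lambda>x. f x + g x) has_derivative
        (\<lambda>v. frechet_derivative f (at x) v + frechet_derivative g (at x) v)) (at x)" if "x \<in> S" for x
      by (rule has_derivative_add[OF Suc.prems[THEN Ck_on_derivative, OF that]])
  qed (use Suc in auto)
qed

lemma Ck_on_sum:
  assumes "open S" "\<And>i. i \<in> A \<Longrightarrow> Ck_on k S (f i)"
  shows "Ck_on k S (\<lambda>x. \<Sum>i\<in>A. f i x)"
  using assms(2)
  by (induction A rule: infinite_finite_induct) (auto intro: Ck_on_const Ck_on_add assms(1))

lemma Ck_on_Pair:
  assumes "open S" "Ck_on k S f" "Ck_on k S g"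
  shows "Ck_on k S (\<lambda>x. (f x, g x))"
  using assms(2,3)
proof (induction k arbitrary: f g)
  case 0
  then show ?case by (simp add: continuous_on_Pair)
next
  case (Suc k)
  show ?case
  proof (rule Ck_on_Suc_intro[OF assms(1)])
    show "((\<lambda>x. (f x, g x)) has_derivative
        (\<lambda>v. (frechet_derivative f (at x) v, frechet_derivative g (at x) v))) (at x)" if "x \<in> S" for x
      by (rule has_derivative_Pair[OF Suc.prems[THEN Ck_on_derivative, OF that]])
  qed (use Suc in auto)
qed

lemma Ck_on_bounded_bilinear:
  assumes "open S" "bounded_bilinear B" "Ck_on k S f" "Ck_on k S g"
  shows "Ck_on k S (\<lambda>x. B (f x) (g x))"
  using assms(3,4)
proof (induction k arbitrary: f g)
  case 0
  then show ?case
    using assms(2) by (simp add: bounded_bilinear.continuous_on)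
next
  case (Suc k)
  show ?case
  proof (rule Ck_on_Suc_intro[OF assms(1)])
    show "((\<lambda>x. B (f x) (g x)) has_derivative
        (\<lambda>v. B (f x) (frechet_derivative g (at x) v) + B (frechet_derivative f (at x) v) (g x))) (at x)"
      if "x \<in> S" for x
      by (rule bounded_bilinear.FDERIV[OF assms(2) Suc.prems[THEN Ck_on_derivative, OF that]])
    show "Ck_on k S (\<lambda>x. B (f x) (frechet_derivative g (at x) v) + B (frechet_derivative f (at x) v) (g x))"
      for v
      using Suc.prems Suc.prems[THEN Ck_on_Suc] by (intro Ck_on_add assms(1) Suc.IH) (simp_all only: Ck_on.simps)
  qed
qed

lemma Ck_on_prod:
  fixes f :: "'i \<Rightarrow> 'a::real_normed_vector \<Rightarrow> real"
  assumes "open S" "\<And>i. i \<in> A \<Longrightarrow> Ck_on k S (f i)"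
  shows "Ck_on k S (\<lambda>x. \<Prod>i\<in>A. f i x)"
  using assms(2)
  by (induction A rule: infinite_finite_induct)
    (auto intro: Ck_on_const Ck_on_bounded_bilinear[OF assms(1) bounded_bilinear_mult])

lemma linear_Basis_expansion:
  fixes L :: "'b::euclidean_space \<Rightarrow> 'c::real_vector"
  assumes "linear L"
  shows "L v = (\<Sum>b\<in>Basis. (v \<bullet> b) *\<^sub>R L b)"
  by (metis (no_types, lifting) assms euclidean_representation linear_sum linear_scale sum.cong)

text \<open>Expanding \<open>f x\<close> in the basis gives a finite sum of products of scalar and
  vector functions. Regularity of the linear maps is thus measured on fixed vectors, without a
  topology on operators.\<close>

lemma Ck_on_linear_family:
  fixes L :: "'a::real_normed_vector \<Rightarrow> 'b::euclidean_space \<Rightarrow> 'c::real_normed_vector"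
  assumes "open S" "\<And>x. x \<in> S \<Longrightarrow> linear (L x)" "\<And>b. Ck_on k S (\<lambda>x. L x b)" "Ck_on k S f"
  shows "Ck_on k S (\<lambda>x. L x (f x))"
proof (rule Ck_on_cong[OF assms(1)])
  show "(\<Sum>b\<in>Basis. (f x \<bullet> b) *\<^sub>R L x b) = L x (f x)" if "x \<in> S" for x
    using linear_Basis_expansion[OF assms(2)[OF that]] by metis
  show "Ck_on k S (\<lambda>x. \<Sum>b\<in>Basis. (f x \<bullet> b) *\<^sub>R L x b)"
    using assms by (intro Ck_on_sum Ck_on_bounded_bilinear[OF _ bounded_bilinear_scaleR]
        Ck_on_bounded_linear_compose[OF _ bounded_linear_inner_left])
qed

text \<open>By the chain rule the derivative is a linear family evaluated at the derivative of
  \<open>f\<close>. The induction hypothesis, applied to the directional derivatives of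
  \<open>g\<close>, makes this family of class \<open>k\<close>.\<close>

lemma Ck_on_compose:
  fixes f :: "'a::real_normed_vector \<Rightarrow> 'b::euclidean_space" and g :: "'b \<Rightarrow> 'c::real_normed_vector"
  assumes "open S" "Ck_on k S f" "Ck_on k T g" "f ` S \<subseteq> T"
  shows "Ck_on k S (\<lambda>x. g (f x))"
  using assms(2,3)
proof (induction k arbitrary: g)
  case 0
  then show ?case
    using assms(4) by (auto intro: continuous_on_compose2)
next
  case (Suc k)
  have g: "(g has_derivative frechet_derivative g (at (f x))) (at (f x))" if "x \<in> S" for x
    using Ck_on_derivative[OF Suc.prems(2)] assms(4) that by blast
  show ?case
  proof (rule Ck_on_Suc_intro[OF assms(1)])
    show "((\<lambda>x. g (f x)) has_derivative
        (\<lambda>v. frechet_derivative g (at (f x)) (frechet_derivative f (at x) v))) (at x)" if "x \<in> S" for x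
      using diff_chain_at[OF Ck_on_derivative[OF Suc.prems(1) that] g[OF that]] by (simp add: o_def)
    show "Ck_on k S (\<lambda>x. frechet_derivative g (at (f x)) (frechet_derivative f (at x) v))" for v
    proof (rule Ck_on_linear_family[OF assms(1) has_derivative_linear[OF g]])
      show "Ck_on k S (\<lambda>x. frechet_derivative g (at (f x)) b)" for b
        using Suc.prems(2) by (intro Suc.IH Ck_on_Suc[OF Suc.prems(1)]) simp
    qed (use Suc.prems(1) in auto)
  qed
qed

text \<open>The derivative of the reciprocal is a polynomial in the reciprocal itself, so each order
  of regularity yields the next.\<close>

lemma Ck_on_inverse: "Ck_on k (- {0}) (inverse :: real \<Rightarrow> real)"
proof (induction k)
  case 0
  then show ?case by (auto intro!: continuous_intros)
next
  case (Suc k)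
  have o: "open (- {0::real})" by auto
  show ?case
  proof (rule Ck_on_Suc_intro[OF o])
    show "(inverse has_derivative (\<lambda>v. - (inverse x * v * inverse x))) (at x)" if "x \<in> - {0}" for x :: real
      using that by (auto intro!: has_derivative_inverse' derivative_eq_intros)
    show "Ck_on k (- {0}) (\<lambda>x. - (inverse x * v * inverse x))" for v :: real
      by (intro Ck_on_bounded_linear_compose[OF o bounded_linear_minus[OF bounded_linear_ident]]
          Ck_on_bounded_bilinear[OF o bounded_bilinear_mult] Ck_on_const Suc o)
  qed
qed

lemma Ck_on_divide:
  fixes f g :: "'a::real_normed_vector \<Rightarrow> real"
  assumes "open S" "Ck_on k S f" "Ck_on k S g" "\<And>x. x \<in> S \<Longrightarrow> g x \<noteq> 0"
  shows "Ck_on k S (\<lambda>x. f x / g x)"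
proof -
  have "Ck_on k S (\<lambda>x. inverse (g x))"
    using assms(4) by (intro Ck_on_compose[OF assms(1,3) Ck_on_inverse]) auto
  then show ?thesis
    unfolding divide_inverse by (rule Ck_on_bounded_bilinear[OF assms(1) bounded_bilinear_mult assms(2)])
qed

lemma Ck_on_vec_lambda:
  fixes f :: "'i::finite \<Rightarrow> 'a::real_normed_vector \<Rightarrow> real"
  assumes "open S" "\<And>i. Ck_on k S (f i)"
  shows "Ck_on k S (\<lambda>x. \<chi> i. f i x)"
proof (rule Ck_on_cong[OF assms(1)])
  show "Ck_on k S (\<lambda>x. \<Sum>i\<in>UNIV. f i x *\<^sub>R axis i 1)"
    using assms by (intro Ck_on_sum Ck_on_bounded_bilinear[OF _ bounded_bilinear_scaleR] Ck_on_const)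
  show "(\<Sum>i\<in>UNIV. f i x *\<^sub>R axis i 1) = (\<chi> i. f i x)" for x
    using basis_expansion[of "\<chi> i. f i x"] by (simp add: scalar_mult_eq_scaleR)
qed

lemma Ck_on_det:
  fixes M :: "'a::real_normed_vector \<Rightarrow> real^'k^'k"
  assumes "open S" "\<And>i j. Ck_on k S (\<lambda>x. M x $ i $ j)"
  shows "Ck_on k S (\<lambda>x. det (M x))"
  unfolding det_def using assms
  by (intro Ck_on_sum Ck_on_bounded_bilinear[OF _ bounded_bilinear_mult] Ck_on_const Ck_on_prod)

section \<open>Closure properties of smooth maps, obtained order by order\<close>

lemma smooth_on_Ck: "smooth_on S f \<Longrightarrow> Ck_on k S f"
  by (simp add: smooth_on_def)

lemma smooth_on_cong:
  "open S \<Longrightarrow> (\<And>x. x \<in> S \<Longrightarrow> f x = g x) \<Longrightarrow> smooth_on S f \<Longrightarrow> smooth_on S g"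
  unfolding smooth_on_def using Ck_on_cong[of S f g] by metis

lemma smooth_on_subset: "smooth_on S f \<Longrightarrow> T \<subseteq> S \<Longrightarrow> smooth_on T f"
  unfolding smooth_on_def using Ck_on_subset by metis

lemma smooth_on_local:
  "(\<And>x. x \<in> S \<Longrightarrow> \<exists>T. open T \<and> x \<in> T \<and> smooth_on T f) \<Longrightarrow> smooth_on S f"
  unfolding smooth_on_def by (meson Ck_on_local)

lemma smooth_on_const: "smooth_on S (\<lambda>x. c)"
  by (simp add: smooth_on_def Ck_on_const)

lemma smooth_on_bounded_linear: "open S \<Longrightarrow> bounded_linear L \<Longrightarrow> smooth_on S L"
  by (simp add: smooth_on_def Ck_on_bounded_linear)

lemma smooth_on_bounded_linear_compose:
  "open S \<Longrightarrow> bounded_linear L \<Longrightarrow> smooth_on S f \<Longrightarrow> smooth_on S (\<lambda>x. L (f x))"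
  by (simp add: smooth_on_def Ck_on_bounded_linear_compose)

lemma smooth_on_add:
  "open S \<Longrightarrow> smooth_on S f \<Longrightarrow> smooth_on S g \<Longrightarrow> smooth_on S (\<lambda>x. f x + g x)"
  by (simp add: smooth_on_def Ck_on_add)

lemma smooth_on_diff:
  "open S \<Longrightarrow> smooth_on S f \<Longrightarrow> smooth_on S g \<Longrightarrow> smooth_on S (\<lambda>x. f x - g x)"
  using smooth_on_add[of S f "\<lambda>x. - g x"]
    smooth_on_bounded_linear_compose[OF _ bounded_linear_minus[OF bounded_linear_ident]] by auto

lemma smooth_on_Pair:
  "open S \<Longrightarrow> smooth_on S f \<Longrightarrow> smooth_on S g \<Longrightarrow> smooth_on S (\<lambda>x. (f x, g x))"
  by (simp add: smooth_on_def Ck_on_Pair)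

lemma smooth_on_compose:
  fixes f :: "'a::real_normed_vector \<Rightarrow> 'b::euclidean_space"
  shows "open S \<Longrightarrow> smooth_on S f \<Longrightarrow> smooth_on T g \<Longrightarrow> f ` S \<subseteq> T \<Longrightarrow> smooth_on S (\<lambda>x. g (f x))"
  unfolding smooth_on_def using Ck_on_compose by blast

lemma smooth_on_vec_lambda:
  fixes f :: "'i::finite \<Rightarrow> 'a::real_normed_vector \<Rightarrow> real"
  shows "open S \<Longrightarrow> (\<And>i. smooth_on S (f i)) \<Longrightarrow> smooth_on S (\<lambda>x. \<chi> i. f i x)"
  by (simp add: smooth_on_def Ck_on_vec_lambda)

lemma smooth_on_imp_continuous_on: "smooth_on S f \<Longrightarrow> continuous_on S f"
  using smooth_on_Ck Ck_on.simps(1) by blast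

lemma smooth_on_has_derivative:
  "smooth_on S f \<Longrightarrow> x \<in> S \<Longrightarrow> (f has_derivative frechet_derivative f (at x)) (at x)"
  using smooth_on_Ck Ck_on_derivative by blast

lemma smooth_on_frechet_derivative: "smooth_on S f \<Longrightarrow> smooth_on S (\<lambda>x. frechet_derivative f (at x) v)"
  unfolding smooth_on_def by (metis Ck_on.simps(2))

text \<open>Prepared for the rate of the error, where both the base point and the tangent vector
  vary with the parameter.\<close>

lemma smooth_on_frechet_derivative_apply:
  fixes f :: "'a::euclidean_space \<Rightarrow> 'b::real_normed_vector"
  assumes "open S" "open T" "smooth_on S f" "smooth_on T p" "p ` T \<subseteq> S" "smooth_on T v"
  shows "smooth_on T (\<lambda>z. frechet_derivative f (at (p z)) (v z))"
  unfolding smooth_on_def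
proof
  fix k
  have lin: "linear (frechet_derivative f (at (p z)))" if "z \<in> T" for z
    using smooth_on_has_derivative[OF assms(3)] that assms(5) has_derivative_linear by blast
  have Ck: "Ck_on k T (\<lambda>z. frechet_derivative f (at (p z)) b)" for b
    using smooth_on_compose[OF assms(2,4) smooth_on_frechet_derivative[OF assms(3)] assms(5)]
    by (rule smooth_on_Ck)
  show "Ck_on k T (\<lambda>z. frechet_derivative f (at (p z)) (v z))"
    by (rule Ck_on_linear_family[OF assms(2) lin Ck smooth_on_Ck[OF assms(6)]])
qed

section \<open>Smooth local inverses\<close>

lemma smooth_inverse_function_theorem:
  fixes A :: "real^'k \<Rightarrow> real^'k"
  assumes "open S" "smooth_on S A" "z0 \<in> S" "surj (frechet_derivative A (at z0))"
  obtains P Q B where "open P" "z0 \<in> P" "P \<subseteq> S" "open Q" "homeomorphism P Q A B" "smooth_on Q B"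
proof -
  define A' where "A' x = Blinfun (frechet_derivative A (at x))" for x
  have A'[simp]: "blinfun_apply (A' x) = frechet_derivative A (at x)" if "x \<in> S" for x
    unfolding A'_def using smooth_on_has_derivative[OF assms(2) that]
    by (simp add: bounded_linear_Blinfun_apply has_derivative_bounded_linear)
  have der: "(A has_derivative blinfun_apply (A' x)) (at x)" if "x \<in> S" for x
    using smooth_on_has_derivative[OF assms(2) that] A'[OF that] by simp
  \<comment> \<open>In finite dimension, continuity of the derivative in operator norm follows from
    continuity in each fixed direction.\<close>
  have cont: "continuous_on S A'"
  proof (rule continuous_on_blinfun_componentwise)
    fix b :: "real^'k"
    show "continuous_on S (\<lambda>x. blinfun_apply (A' x) b)"
      using smooth_on_imp_continuous_on[OF smooth_on_frechet_derivative[OF assms(2)]]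
      by (simp cong: continuous_on_cong)
  qed
  \<comment> \<open>A surjective endomorphism of a finite-dimensional space is injective, which
    supplies the left inverse that \<open>inverse_function_theorem\<close> asks for.\<close>
  obtain L where L: "linear L" "L \<circ> blinfun_apply (A' z0) = id"
  proof -
    have lin: "linear (blinfun_apply (A' z0))"
      by (rule bounded_linear.linear[OF blinfun.bounded_linear_right])
    moreover have "inj (blinfun_apply (A' z0))"
      using linear_surjective_imp_injective[OF lin] assms(3,4) by simp
    ultimately show thesis
      using linear_injective_left_inverse that by blast
  qed
  define L' where "L' = Blinfun L"
  have L': "L' o\<^sub>L A' z0 = id_blinfun"
    using L by (intro blinfun_eqI)
      (simp add: L'_def bounded_linear_Blinfun_apply linear_conv_bounded_linear fun_eq_iff)
  from inverse_function_theorem[OF assms(1) der cont assms(3) L'] obtain P Q B B' where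
    PQ: "open P" "P \<subseteq> S" "z0 \<in> P" "open Q" "homeomorphism P Q A B"
    and B: "\<And>y. y \<in> Q \<Longrightarrow> (B has_derivative (B' y)) (at y)"
    and B': "\<And>y. y \<in> Q \<Longrightarrow> B' y = inv (blinfun_apply (A' (B y)))"
    and bij: "\<And>y. y \<in> Q \<Longrightarrow> bij (blinfun_apply (A' (B y)))"
    by metis
  have BS: "B y \<in> S" if "y \<in> Q" for y
    using PQ that homeomorphism_image2 by blast
  \<comment> \<open>By Cramer's rule \<open>B'\<close> is a smooth expression in \<open>B\<close>, so the regularity of \<open>B\<close> bootstraps.\<close>
  define M where "M y = matrix (frechet_derivative A (at (B y)))" for y
  have lin: "linear (frechet_derivative A (at (B y)))" if "y \<in> Q" for y
    using smooth_on_has_derivative[OF assms(2) BS[OF that]] has_derivative_linear by blast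
  have bij': "bij (frechet_derivative A (at (B y)))" if "y \<in> Q" for y
    using bij[OF that] A'[OF BS[OF that]] by simp
  have detM: "det (M y) \<noteq> 0" if "y \<in> Q" for y
    unfolding M_def using det_nz_iff_inj[OF lin[OF that]] bij'[OF that] bij_is_inj by blast
  have B'_cramer: "B' y v = (\<chi> l. det (\<chi> i j. if j = l then v $ i else M y $ i $ j) / det (M y))"
    if "y \<in> Q" for y v
  proof -
    have "B' y = inv (frechet_derivative A (at (B y)))"
      using B'[OF that] A'[OF BS[OF that]] by simp
    then have "frechet_derivative A (at (B y)) (B' y v) = v"
      using surj_f_inv_f[OF bij_is_surj[OF bij'[OF that]]] by simp
    then have "M y *v B' y v = v"
      unfolding M_def by (simp add: matrix_works lin[OF that] linear_matrix_vector_mul_eq)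
    then show ?thesis
      using cramer[OF detM[OF that]] by blast
  qed
  have "Ck_on k Q B" for k
  proof (induction k)
    case 0
    show ?case using PQ(5) by (simp add: homeomorphism_def)
  next
    case (Suc k)
    have M: "Ck_on k Q (\<lambda>y. M y $ i $ j)" for i j
      unfolding M_def matrix_def
      using Ck_on_bounded_linear_compose[OF PQ(4) bounded_linear_vec_nth
          Ck_on_compose[OF PQ(4) Suc smooth_on_Ck[OF smooth_on_frechet_derivative[OF assms(2)]]],
          of "axis j 1" i] BS
      by auto
    show ?case
    proof (rule Ck_on_Suc_intro[OF PQ(4) B])
      fix v
      have "Ck_on k Q (\<lambda>y. \<chi> l. det (\<chi> i j. if j = l then v $ i else M y $ i $ j) / det (M y))"
      proof (intro Ck_on_vec_lambda Ck_on_divide Ck_on_det PQ(4) detM)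
        show "Ck_on k Q (\<lambda>y. (\<chi> i j. if j = l then v $ i else M y $ i $ j) $ i $ j)" for l i j
          using M by (cases "j = l") (auto simp: Ck_on_const)
        show "Ck_on k Q (\<lambda>y. M y $ i $ j)" for i j
          by (rule M)
      qed
      from Ck_on_cong[OF PQ(4) B'_cramer[symmetric] this]
      show "Ck_on k Q (\<lambda>y. B' y v)" .
    qed
  qed
  then show thesis
    using that PQ by (auto simp: smooth_on_def)
qed

subsection \<open>Local actions\<close>

text \<open>Nearness to a point is expressed from here on by functions that converge along an
  arbitrary filter, so that one statement serves in neighbourhoods of different product
  spaces.\<close>

lemma tendsto_continuous_on:
  fixes f :: "'a::t2_space \<Rightarrow> 'b::topological_space"
  assumes "continuous_on S f" "open S" "(p \<longlongrightarrow> l) A" "l \<in> S"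
  shows "((\<lambda>z. f (p z)) \<longlongrightarrow> f l) A"
proof -
  have "continuous (at l) f"
    using assms continuous_on_eq_continuous_at by blast
  then show ?thesis
    using assms(3) by (rule isCont_tendsto_compose)
qed

lemma eventually_in_open: "(p \<longlongrightarrow> l) A \<Longrightarrow> open S \<Longrightarrow> l \<in> S \<Longrightarrow> \<forall>\<^sub>F z in A. p z \<in> S"
  by (rule topological_tendstoD)

lemma eventually_nhds_tendsto: "\<forall>\<^sub>F z in nhds l. P z \<Longrightarrow> (p \<longlongrightarrow> l) A \<Longrightarrow> \<forall>\<^sub>F z in A. P (p z)"
  using filterlim_iff by blast

lemma tendsto_fst_nhds: "(fst \<longlongrightarrow> fst z) (nhds z)"
  by (rule tendsto_fst[OF filterlim_ident])

lemma tendsto_snd_nhds: "(snd \<longlongrightarrow> snd z) (nhds z)"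
  by (rule tendsto_snd[OF filterlim_ident])

context lie_group
begin

lemma chart_at:
  obtains U \<kappa> where "(U, \<kappa>) \<in> atlas" "g \<in> U" "open U" "open (\<kappa> ` U)"
    "homeomorphism U (\<kappa> ` U) \<kappa> (inv_into U \<kappa>)"
proof -
  have "g \<in> (\<Union>(U, \<kappa>)\<in>atlas. U)"
    by (simp only: charts_cover UNIV_I)
  then obtain U \<kappa> where "(U, \<kappa>) \<in> atlas" "g \<in> U"
    by (elim UN_E) (auto split: prod.splits)
  moreover have "is_chart (U, \<kappa>)"
    using charts calculation(1) .
  ultimately show thesis
    using that unfolding is_chart_def prod.case by blast
qed

lemma tendsto_gmul:
  assumes "(p \<longlongrightarrow> g) A" "(q \<longlongrightarrow> k) A"
  shows "((\<lambda>z. gmul (p z) (q z)) \<longlongrightarrow> gmul g k) A"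
  using tendsto_continuous_on[OF mult_continuous open_UNIV tendsto_Pair[OF assms] UNIV_I]
  by (simp only: prod.case)

lemma tendsto_ginv: "(p \<longlongrightarrow> g) A \<Longrightarrow> ((\<lambda>z. ginv (p z)) \<longlongrightarrow> ginv g) A"
  by (rule tendsto_continuous_on[OF inv_continuous open_UNIV _ UNIV_I])

end

text \<open>Makes the action of a fixed group element a special case of the action of a varying
  one.\<close>

lemma smooth_into_group_const: "smooth_into_group atlas S (\<lambda>x. g)"
  by (auto simp: smooth_into_group_def smooth_on_const)

text \<open>Fixes one witness \<open>D\<close> for the domain that is existentially quantified in
  \<open>local_transformation_group\<close>. Composition is then controlled by membership in this
  open set.\<close>

locale local_action = lie_group gmul e ginv atlas
  for gmul :: "'g::{t2_space, second_countable_topology} \<Rightarrow> 'g \<Rightarrow> 'g" and e ginv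
    and atlas :: "('g set \<times> ('g \<Rightarrow> real^'r)) set" +
  fixes S :: "'a::euclidean_space set" and D :: "('g \<times> 'a) set" and \<alpha> :: "'g \<Rightarrow> 'a \<Rightarrow> 'a"
  assumes domain_open: "open D"
    and e_domain: "\<xi> \<in> S \<Longrightarrow> (e, \<xi>) \<in> D"
    and domain_space: "(g, \<xi>) \<in> D \<Longrightarrow> \<xi> \<in> S"
    and action_closed: "(g, \<xi>) \<in> D \<Longrightarrow> \<alpha> g \<xi> \<in> S"
    and action_smooth: "smooth_on_group_times atlas D \<alpha>"
    and action_e: "\<xi> \<in> S \<Longrightarrow> \<alpha> e \<xi> = \<xi>"
    and action_gmul: "(g1, \<xi>) \<in> D \<Longrightarrow> (g2, \<alpha> g1 \<xi>) \<in> D \<Longrightarrow> (gmul g2 g1, \<xi>) \<in> D \<Longrightarrow>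
      \<alpha> g2 (\<alpha> g1 \<xi>) = \<alpha> (gmul g2 g1) \<xi>"
begin

lemma action_ginv:
  assumes "(g, \<xi>) \<in> D" "(ginv g, \<alpha> g \<xi>) \<in> D"
  shows "\<alpha> (ginv g) (\<alpha> g \<xi>) = \<xi>"
  using action_gmul[OF assms] e_domain action_e domain_space[OF assms(1)] by simp

lemma chart_action_smooth:
  assumes "(U, \<kappa>) \<in> atlas"
  shows "smooth_on {(b, \<xi>). b \<in> \<kappa> ` U \<and> (inv_into U \<kappa> b, \<xi>) \<in> D} (\<lambda>(b, \<xi>). \<alpha> (inv_into U \<kappa> b) \<xi>)"
  using action_smooth assms by (auto simp: smooth_on_group_times_def)

text \<open>Regularity of the action is given in charts only. Near \<open>(g, \<xi>)\<close> the
  action is the chart followed by its smooth coordinate expression, hence continuous.\<close>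

lemma tendsto_action:
  assumes "(p \<longlongrightarrow> g) A" "(q \<longlongrightarrow> \<xi>) A" "(g, \<xi>) \<in> D"
  shows "((\<lambda>z. \<alpha> (p z) (q z)) \<longlongrightarrow> \<alpha> g \<xi>) A"
proof -
  obtain U \<kappa> where U: "(U, \<kappa>) \<in> atlas" "g \<in> U" "open U" "homeomorphism U (\<kappa> ` U) \<kappa> (inv_into U \<kappa>)"
    using chart_at by metis
  let ?T = "D \<inter> U \<times> UNIV"
  have inv: "inv_into U \<kappa> (\<kappa> k) = k" if "k \<in> U" for k
    using U(4) that by (simp add: homeomorphism_def)
  have "continuous_on ?T (\<lambda>z. (\<kappa> (fst z), snd z))"
  proof (rule continuous_on_Pair)
    have "continuous_on U \<kappa>"
      using U(4) by (simp add: homeomorphism_def)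
    then show "continuous_on ?T (\<lambda>z. \<kappa> (fst z))"
      by (rule continuous_on_compose2[OF _ continuous_on_fst[OF continuous_on_id]]) auto
  qed (rule continuous_on_snd[OF continuous_on_id])
  moreover have "(\<lambda>z. (\<kappa> (fst z), snd z)) ` ?T \<subseteq> {(b, \<xi>). b \<in> \<kappa> ` U \<and> (inv_into U \<kappa> b, \<xi>) \<in> D}"
    using inv by auto
  ultimately have "continuous_on ?T (\<lambda>z. case (\<kappa> (fst z), snd z) of (b, \<xi>) \<Rightarrow> \<alpha> (inv_into U \<kappa> b) \<xi>)"
    by (rule continuous_on_compose2[OF smooth_on_imp_continuous_on[OF chart_action_smooth[OF U(1)]]])
  then have "continuous_on ?T (\<lambda>(k, \<xi>). \<alpha> k \<xi>)"
    by (rule continuous_on_eq) (auto simp: inv)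
  from tendsto_continuous_on[OF this _ tendsto_Pair[OF assms(1,2)]]
  have "((\<lambda>z. case (p z, q z) of (k, \<xi>) \<Rightarrow> \<alpha> k \<xi>) \<longlongrightarrow> (case (g, \<xi>) of (k, \<xi>) \<Rightarrow> \<alpha> k \<xi>)) A"
    using open_Int[OF domain_open open_Times[OF U(3) open_UNIV]] assms(3) U(2) by blast
  then show ?thesis
    by (simp only: prod.case)
qed

lemma eventually_domain:
  "(p \<longlongrightarrow> g) A \<Longrightarrow> (q \<longlongrightarrow> \<xi>) A \<Longrightarrow> (g, \<xi>) \<in> D \<Longrightarrow> \<forall>\<^sub>F z in A. (p z, q z) \<in> D"
  using eventually_in_open[OF tendsto_Pair domain_open] by blast

text \<open>Smoothness is local, so it is enough to look at the open part of \<open>T\<close> that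
  \<open>\<gamma> \<circ> q\<close> maps into one chart domain. There the coordinate expressions of
  \<open>\<gamma>\<close> and of the action can be composed as maps between Euclidean
  spaces.\<close>

lemma smooth_on_action:
  fixes p :: "'b::real_normed_vector \<Rightarrow> 'a" and q :: "'b \<Rightarrow> 'c::euclidean_space"
  assumes "open T" "open W" "smooth_into_group atlas W \<gamma>" "smooth_on T q" "q ` T \<subseteq> W" "smooth_on T p"
    and "\<And>z. z \<in> T \<Longrightarrow> (\<gamma> (q z), p z) \<in> D"
  shows "smooth_on T (\<lambda>z. \<alpha> (\<gamma> (q z)) (p z))"
proof (rule smooth_on_local)
  fix z assume z: "z \<in> T"
  obtain U \<kappa> where U: "(U, \<kappa>) \<in> atlas" "\<gamma> (q z) \<in> U" "open U"
      "homeomorphism U (\<kappa> ` U) \<kappa> (inv_into U \<kappa>)"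
    using chart_at by metis
  have inv: "inv_into U \<kappa> (\<kappa> k) = k" if "k \<in> U" for k
    using U(4) that by (simp add: homeomorphism_def)
  define T' where "T' = T \<inter> (\<lambda>z. \<gamma> (q z)) -` U"
  have "continuous_on T (\<lambda>z. \<gamma> (q z))"
    using assms(3) continuous_on_compose2[OF _ smooth_on_imp_continuous_on[OF assms(4)] assms(5)]
    unfolding smooth_into_group_def by blast
  then have T': "open T'" "z \<in> T'" "T' \<subseteq> T"
    using continuous_open_preimage[OF _ assms(1) U(3)] z U(2) by (auto simp: T'_def)
  have "smooth_on T' (\<lambda>z. \<kappa> (\<gamma> (q z)))"
  proof (rule smooth_on_compose[OF T'(1) smooth_on_subset[OF assms(4) T'(3)]])
    show "smooth_on {x \<in> W. \<gamma> x \<in> U} (\<lambda>x. \<kappa> (\<gamma> x))"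
      using assms(3) U(1) by (auto simp: smooth_into_group_def)
    show "q ` T' \<subseteq> {x \<in> W. \<gamma> x \<in> U}"
      using assms(5) by (auto simp: T'_def)
  qed
  then have "smooth_on T' (\<lambda>z. (\<kappa> (\<gamma> (q z)), p z))"
    by (rule smooth_on_Pair[OF T'(1) _ smooth_on_subset[OF assms(6) T'(3)]])
  moreover have "(\<lambda>z. (\<kappa> (\<gamma> (q z)), p z)) ` T' \<subseteq> {(b, \<xi>). b \<in> \<kappa> ` U \<and> (inv_into U \<kappa> b, \<xi>) \<in> D}"
    using assms(7) inv by (auto simp: T'_def)
  ultimately have "smooth_on T' (\<lambda>z. case (\<kappa> (\<gamma> (q z)), p z) of (b, \<xi>) \<Rightarrow> \<alpha> (inv_into U \<kappa> b) \<xi>)"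
    by (rule smooth_on_compose[OF T'(1) _ chart_action_smooth[OF U(1)]])
  from smooth_on_cong[OF T'(1) _ this] have "smooth_on T' (\<lambda>z. \<alpha> (\<gamma> (q z)) (p z))"
    by (simp add: T'_def inv)
  then show "\<exists>T. open T \<and> z \<in> T \<and> smooth_on T (\<lambda>z. \<alpha> (\<gamma> (q z)) (p z))"
    using T' by blast
qed

lemma smooth_on_action_fixed:
  fixes p :: "'b::euclidean_space \<Rightarrow> 'a"
  assumes "open T" "smooth_on T p" "\<And>z. z \<in> T \<Longrightarrow> (g, p z) \<in> D"
  shows "smooth_on T (\<lambda>z. \<alpha> g (p z))"
  using smooth_on_action[OF assms(1) open_UNIV smooth_into_group_const
      smooth_on_bounded_linear[OF assms(1) bounded_linear_ident] _ assms(2,3)] by simp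

text \<open>The section of the open set \<open>D\<close> at a fixed \<open>g\<close> is open, and
  \<open>\<alpha> g\<close> is smooth on it.\<close>

lemma action_has_derivative:
  assumes "(g, \<xi>) \<in> D"
  shows "(\<alpha> g has_derivative frechet_derivative (\<alpha> g) (at \<xi>)) (at \<xi>)"
proof -
  let ?T = "{\<xi>. (g, \<xi>) \<in> D}"
  have "open ?T"
    using open_vimage[OF domain_open continuous_on_Pair[OF continuous_on_const continuous_on_id]]
    by (simp add: vimage_def)
  then have "smooth_on ?T (\<lambda>\<xi>. \<alpha> g \<xi>)"
    by (intro smooth_on_action_fixed smooth_on_bounded_linear bounded_linear_ident) auto
  then show ?thesis
    using smooth_on_has_derivative assms by blast
qed

end

lemma local_transformation_group_action:
  fixes S :: "'a::euclidean_space set"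
  assumes "lie_group gmul e ginv atlas" "local_transformation_group gmul e atlas S \<alpha>"
  obtains D where "local_action gmul e ginv atlas S D \<alpha>"
proof -
  obtain D where "open D" "{e} \<times> S \<subseteq> D" "D \<subseteq> UNIV \<times> S" "\<forall>(g, \<xi>)\<in>D. \<alpha> g \<xi> \<in> S"
    "smooth_on_group_times atlas D \<alpha>" "\<forall>\<xi>\<in>S. \<alpha> e \<xi> = \<xi>"
    "\<forall>g1 g2 \<xi>. (g1, \<xi>) \<in> D \<and> (g2, \<alpha> g1 \<xi>) \<in> D \<and> (gmul g2 g1, \<xi>) \<in> D \<longrightarrow>
       \<alpha> g2 (\<alpha> g1 \<xi>) = \<alpha> (gmul g2 g1) \<xi>"
    using assms(2) unfolding local_transformation_group_def by auto
  then have "local_action gmul e ginv atlas S D \<alpha>"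
    by (intro local_action.intro assms(1) local_action_axioms.intro) auto
  then show thesis by (rule that)
qed


subsection \<open>Moving frames\<close>

text \<open>Here \<open>M\<close> is a fixed witness for the open region of the group in which the
  normalization equation has a unique solution. Every identification of a frame below comes down to
  membership in \<open>M\<close>.\<close>

locale moving_frame = local_action gmul e ginv atlas X D \<phi>
  for gmul :: "'g::{t2_space, second_countable_topology} \<Rightarrow> 'g \<Rightarrow> 'g" and e ginv
    and atlas :: "('g set \<times> ('g \<Rightarrow> real^'r)) set"
    and X :: "(real^'n) set" and D :: "('g \<times> (real^'n)) set" and \<phi> :: "'g \<Rightarrow> real^'n \<Rightarrow> real^'n" +
  fixes a :: "'r \<Rightarrow> 'n" and c :: "real^'r" and W :: "(real^'n) set" and \<gamma> :: "real^'n \<Rightarrow> 'g"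
    and M :: "'g set"
  assumes inj_a: "inj a" and W_open: "open W" and W_X: "W \<subseteq> X"
    and frame_smooth: "smooth_into_group atlas W \<gamma>"
    and M_open: "open M" and frame_M: "x \<in> W \<Longrightarrow> \<gamma> x \<in> M"
    and frame_unique: "x \<in> W \<Longrightarrow> g \<in> M \<Longrightarrow> comps a (\<phi> g x) = c \<longleftrightarrow> g = \<gamma> x"
begin

lemma comps_frame: "x \<in> W \<Longrightarrow> comps a (\<phi> (\<gamma> x) x) = c"
  using frame_unique frame_M by blast

lemma tendsto_frame: "(p \<longlongrightarrow> x) A \<Longrightarrow> x \<in> W \<Longrightarrow> ((\<lambda>z. \<gamma> (p z)) \<longlongrightarrow> \<gamma> x) A"
  using tendsto_continuous_on[OF _ W_open] frame_smooth by (auto simp: smooth_into_group_def)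

text \<open>The element \<open>gmul (\<gamma> (p z)) (ginv (s z))\<close> normalizes the moved
  point, because \<open>s z\<close> cancels. It tends to \<open>\<gamma> x1\<close> and so
  eventually lies in \<open>M\<close>, where uniqueness identifies it with the frame of the moved
  point.\<close>

lemma frame_equivariant:
  assumes "x1 \<in> W" "(\<gamma> x1, x1) \<in> D" "(s \<longlongrightarrow> e) A" "(p \<longlongrightarrow> x1) A"
  shows "\<forall>\<^sub>F z in A. p z \<in> W \<and> \<phi> (s z) (p z) \<in> W \<and> \<gamma> (\<phi> (s z) (p z)) = gmul (\<gamma> (p z)) (ginv (s z))"
proof -
  note e_D = e_domain[OF subsetD[OF W_X assms(1)]]
  have p': "((\<lambda>z. \<phi> (s z) (p z)) \<longlongrightarrow> x1) A"
    using tendsto_action[OF assms(3,4) e_D] action_e W_X assms(1) by auto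
  have "ginv e = e"
    using right_inverse group_left_neutral by metis
  then have s': "((\<lambda>z. gmul (\<gamma> (p z)) (ginv (s z))) \<longlongrightarrow> \<gamma> x1) A"
    using tendsto_gmul[OF tendsto_frame[OF assms(4,1)] tendsto_ginv[OF assms(3)]] by simp
  show ?thesis
    using eventually_in_open[OF assms(4) W_open assms(1)] eventually_in_open[OF p' W_open assms(1)]
      eventually_in_open[OF s' M_open frame_M[OF assms(1)]] eventually_domain[OF assms(3,4) e_D]
      eventually_domain[OF s' p' assms(2)]
      eventually_domain[OF tendsto_frame[OF assms(4,1)] assms(4,2)]
  proof eventually_elim
    case (elim z)
    have "\<phi> (gmul (\<gamma> (p z)) (ginv (s z))) (\<phi> (s z) (p z)) = \<phi> (\<gamma> (p z)) (p z)"
      using action_gmul[of "s z" "p z" "gmul (\<gamma> (p z)) (ginv (s z))"] elim by (simp add: assoc)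
    then show ?case
      using frame_unique[OF elim(2,3)] comps_frame[OF elim(1)] elim by simp
  qed
qed

text \<open>By \<open>frame_equivariant\<close> the factor \<open>s z\<close> cancels once more. A
  second action \<open>\<alpha>\<close> of the same group is allowed, so that the result covers the
  state, its estimate and the input.\<close>

lemma normalized_invariant:
  assumes "local_action gmul e ginv atlas S D' \<alpha>" "x1 \<in> W" "(\<gamma> x1, x1) \<in> D" "(\<gamma> x1, y1) \<in> D'"
    and "(s \<longlongrightarrow> e) A" "(p \<longlongrightarrow> x1) A" "(q \<longlongrightarrow> y1) A"
  shows "\<forall>\<^sub>F z in A. \<alpha> (\<gamma> (\<phi> (s z) (p z))) (\<alpha> (s z) (q z)) = \<alpha> (\<gamma> (p z)) (q z)"
proof -
  interpret A: local_action gmul e ginv atlas S D' \<alpha> by fact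
  note y1 = A.domain_space[OF assms(4)]
  have q': "((\<lambda>z. \<alpha> (s z) (q z)) \<longlongrightarrow> y1) A"
    using A.tendsto_action[OF assms(5,7) A.e_domain] A.action_e y1 by simp
  have "ginv e = e"
    using right_inverse group_left_neutral by metis
  then have s': "((\<lambda>z. gmul (\<gamma> (p z)) (ginv (s z))) \<longlongrightarrow> \<gamma> x1) A"
    using tendsto_gmul[OF tendsto_frame[OF assms(6,2)] tendsto_ginv[OF assms(5)]] by simp
  show ?thesis
    using frame_equivariant[OF assms(2,3,5,6)] A.eventually_domain[OF assms(5,7) A.e_domain[OF y1]]
      A.eventually_domain[OF s' q' assms(4)]
      A.eventually_domain[OF tendsto_frame[OF assms(6,2)] assms(7,4)]
  proof eventually_elim
    case (elim z)
    then show ?case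
      using A.action_gmul[of "s z" "q z" "gmul (\<gamma> (p z)) (ginv (s z))"] by (simp add: assoc)
  qed
qed

text \<open>The group element \<open>\<gamma>(x1)\<^sup>-\<^sup>1 \<gamma>(x)\<close> is close to \<open>e\<close> for \<open>x\<close> close to \<open>x1\<close>, so the local
  invariance properties apply to it.\<close>

lemma tendsto_relative_frame:
  "x1 \<in> W \<Longrightarrow> (p \<longlongrightarrow> x1) A \<Longrightarrow> ((\<lambda>z. gmul (ginv (\<gamma> x1)) (\<gamma> (p z))) \<longlongrightarrow> e) A"
  using tendsto_gmul[OF tendsto_const tendsto_frame, of p x1 A "ginv (\<gamma> x1)"] by simp

text \<open>After normalization by \<open>\<gamma> (p z)\<close>, only the action of the fixed
  element \<open>ginv (\<gamma> x1)\<close> remains. The transported point therefore depends on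
  \<open>z\<close> through the normalized point alone.\<close>

lemma action_relative_frame:
  assumes "local_action gmul e ginv atlas S D' \<alpha>" "x1 \<in> W" "(\<gamma> x1, y1) \<in> D'"
    "(ginv (\<gamma> x1), \<alpha> (\<gamma> x1) y1) \<in> D'" "(p \<longlongrightarrow> x1) A" "(q \<longlongrightarrow> y1) A"
  shows "\<forall>\<^sub>F z in A. \<alpha> (gmul (ginv (\<gamma> x1)) (\<gamma> (p z))) (q z) = \<alpha> (ginv (\<gamma> x1)) (\<alpha> (\<gamma> (p z)) (q z))"
proof -
  interpret A: local_action gmul e ginv atlas S D' \<alpha> by fact
  note \<gamma> = tendsto_frame[OF assms(5,2)]
  show ?thesis
    using A.eventually_domain[OF \<gamma> assms(6,3)]
      A.eventually_domain[OF tendsto_const A.tendsto_action[OF \<gamma> assms(6,3)] assms(4)]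
      A.eventually_domain[OF tendsto_relative_frame[OF assms(2,5)] assms(6)
        A.e_domain[OF A.domain_space[OF assms(3)]]]
    by eventually_elim (simp add: A.action_gmul)
qed

end

subsection \<open>The invariants of a moving frame\<close>

text \<open>Packing drops the components of the state indexed by \<open>range a\<close>. At a
  normalized state these equal \<open>c\<close>, and \<open>unpack_state\<close> puts them
  back.\<close>

definition pack :: "('k \<Rightarrow> 'n + 'm) \<Rightarrow> real^'n \<Rightarrow> real^'m \<Rightarrow> real^'k" where
  "pack \<beta> x u = (\<chi> k. case \<beta> k of Inl i \<Rightarrow> x $ i | Inr j \<Rightarrow> u $ j)"

definition unpack_state :: "('r \<Rightarrow> 'n) \<Rightarrow> real^'r \<Rightarrow> ('k \<Rightarrow> 'n + 'm) \<Rightarrow> real^'k \<Rightarrow> real^'n" where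
  "unpack_state a c \<beta> v = (\<chi> i. if i \<in> range a then c $ inv a i else v $ inv \<beta> (Inl i))"

definition unpack_input :: "('k \<Rightarrow> 'n + 'm) \<Rightarrow> real^'k \<Rightarrow> real^'m" where
  "unpack_input \<beta> v = (\<chi> j. v $ inv \<beta> (Inr j))"

lemma frame_invariant_pack:
  "frame_invariant \<phi> \<psi> \<gamma> \<beta> (x, u) = pack \<beta> (\<phi> (\<gamma> x) x) (\<psi> (\<gamma> x) u)"
  by (simp add: frame_invariant_def pack_def)

context
  fixes a :: "'r::finite \<Rightarrow> 'n::finite" and \<beta> :: "'k::finite \<Rightarrow> 'n + 'm::finite"
  assumes inj_a: "inj a" and \<beta>: "bij_betw \<beta> UNIV ((- range a) <+> UNIV)"
begin

lemma \<beta>_inv: "i \<notin> range a \<Longrightarrow> \<beta> (inv \<beta> (Inl i)) = Inl i" "\<beta> (inv \<beta> (Inr j)) = Inr j"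
  using \<beta> f_inv_into_f[of _ \<beta> UNIV] by (auto simp: bij_betw_def)

lemma comps_unpack_state: "comps a (unpack_state a c \<beta> v) = c"
  by (simp add: comps_def unpack_state_def vec_eq_iff inv_f_f[OF inj_a])

lemma unpack_state_pack: "comps a x = c \<Longrightarrow> unpack_state a c \<beta> (pack \<beta> x u) = x"
  by (auto simp: comps_def unpack_state_def pack_def vec_eq_iff \<beta>_inv inv_f_f[OF inj_a])

lemma unpack_input_pack: "unpack_input \<beta> (pack \<beta> x u) = u"
  by (simp add: unpack_input_def pack_def vec_eq_iff \<beta>_inv)

lemma pack_unpack: "pack \<beta> (unpack_state a c \<beta> v) (unpack_input \<beta> v) = v"
proof -
  have "inj \<beta>"
    using \<beta> by (simp add: bij_betw_def)
  have "pack \<beta> (unpack_state a c \<beta> v) (unpack_input \<beta> v) $ k = v $ k" for k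
  proof (cases "\<beta> k")
    case (Inl i)
    moreover have "\<beta> k \<in> (- range a) <+> UNIV"
      using \<beta> by (auto simp: bij_betw_def)
    ultimately have "i \<notin> range a" "inv \<beta> (Inl i) = k"
      using \<open>inj \<beta>\<close> by (auto intro: inv_f_eq)
    then show ?thesis
      using Inl by (simp add: pack_def unpack_state_def)
  next
    case (Inr j)
    then have "inv \<beta> (Inr j) = k"
      using \<open>inj \<beta>\<close> by (auto intro: inv_f_eq)
    then show ?thesis
      using Inr by (simp add: pack_def unpack_input_def)
  qed
  then show ?thesis
    by (simp add: vec_eq_iff)
qed

lemma card_invariants: "CARD('k) = CARD('n) + CARD('m) - CARD('r)"
proof -
  have "CARD('k) = card ((- range a) <+> (UNIV :: 'm set))"
    by (rule bij_betw_same_card[OF \<beta>])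
  also have "\<dots> = card (- range a) + CARD('m)"
    by (rule card_Plus) auto
  also have "card (- range a) = CARD('n) - CARD('r)"
    using card_image[OF inj_a] by (simp add: Compl_eq_Diff_UNIV card_Diff_subset)
  \<comment> \<open>Subtraction of natural numbers truncates, so moving it past the summand for the
    input uses this inequality.\<close>
  moreover have "CARD('r) \<le> CARD('n)"
    using card_inj_on_le[OF inj_a] by auto
  ultimately show ?thesis by simp
qed

end

lemma smooth_on_pack:
  assumes "open T" "smooth_on T p" "smooth_on T q"
  shows "smooth_on T (\<lambda>z. pack \<beta> (p z) (q z))"
  unfolding pack_def
proof (rule smooth_on_vec_lambda[OF assms(1)])
  fix k
  show "smooth_on T (\<lambda>z. case \<beta> k of Inl i \<Rightarrow> p z $ i | Inr j \<Rightarrow> q z $ j)"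
    using smooth_on_bounded_linear_compose[OF assms(1) bounded_linear_vec_nth assms(2)]
      smooth_on_bounded_linear_compose[OF assms(1) bounded_linear_vec_nth assms(3)]
    by (cases "\<beta> k") auto
qed

lemma smooth_on_unpack_state: "open T \<Longrightarrow> smooth_on T (unpack_state a c \<beta>)"
  unfolding unpack_state_def
proof (rule smooth_on_vec_lambda)
  fix i assume "open T"
  show "smooth_on T (\<lambda>v. if i \<in> range a then c $ inv a i else v $ inv \<beta> (Inl i))"
    using smooth_on_bounded_linear[OF \<open>open T\<close> bounded_linear_vec_nth]
    by (cases "i \<in> range a") (simp_all only: if_True if_False smooth_on_const)
qed

lemma smooth_on_unpack_input: "open T \<Longrightarrow> smooth_on T (unpack_input \<beta>)"
  unfolding unpack_input_def
  by (rule smooth_on_vec_lambda) (auto intro: smooth_on_bounded_linear bounded_linear_vec_nth)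

lemma tendsto_pack:
  assumes "(p \<longlongrightarrow> x) A" "(q \<longlongrightarrow> u) A"
  shows "((\<lambda>z. pack \<beta> (p z) (q z)) \<longlongrightarrow> pack \<beta> x u) A"
  unfolding pack_def
  by (intro vec_tendstoI) (auto split: sum.split intro: tendsto_vec_nth assms)

lemma tendsto_unpack_state: "(p \<longlongrightarrow> v) A \<Longrightarrow> ((\<lambda>z. unpack_state a c \<beta> (p z)) \<longlongrightarrow> unpack_state a c \<beta> v) A"
  by (rule tendsto_continuous_on[OF smooth_on_imp_continuous_on[OF smooth_on_unpack_state[OF open_UNIV]]
        open_UNIV _ UNIV_I])

lemma tendsto_unpack_input: "(p \<longlongrightarrow> v) A \<Longrightarrow> ((\<lambda>z. unpack_input \<beta> (p z)) \<longlongrightarrow> unpack_input \<beta> v) A"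
  by (rule tendsto_continuous_on[OF smooth_on_imp_continuous_on[OF smooth_on_unpack_input[OF open_UNIV]]
        open_UNIV _ UNIV_I])

lemma has_derivative_eventually_eq:
  assumes "(f has_derivative f') (at x)" "\<forall>\<^sub>F z in nhds x. f z = g z"
  shows "(g has_derivative f') (at x)"
proof (rule has_derivative_transform_eventually[OF assms(1)])
  show "\<forall>\<^sub>F z in at x. f z = g z"
    using assms(2) by (auto simp: eventually_at_filter elim: eventually_mono)
  show "f x = g x"
    using assms(2) by (rule eventually_nhds_x_imp_x)
qed simp

lemma eventually_nhds_open:
  assumes "\<forall>\<^sub>F z in nhds l. P z"
  obtains S where "open S" "l \<in> S" "\<forall>z\<in>S. P z"
  using assms unfolding eventually_nhds by (elim exE conjE)

section \<open>The frame invariant of the joint action on states and inputs\<close>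

locale framed_actions = moving_frame gmul e ginv atlas X D \<phi> a c W \<gamma> M +
  input: local_action gmul e ginv atlas U D' \<psi>
  for gmul :: "'g::{t2_space, second_countable_topology} \<Rightarrow> 'g \<Rightarrow> 'g" and e ginv
    and atlas :: "('g set \<times> ('g \<Rightarrow> real^'r)) set"
    and X :: "(real^'n) set" and D \<phi> and a :: "'r \<Rightarrow> 'n" and c W \<gamma> M
    and U :: "(real^'m) set" and D' \<psi> +
  fixes \<beta> :: "'k::finite \<Rightarrow> 'n + 'm"
  assumes \<beta>: "bij_betw \<beta> UNIV ((- range a) <+> UNIV)"
begin

abbreviation (input) "J \<equiv> frame_invariant \<phi> \<psi> \<gamma> \<beta>"

text \<open>Collects the domain conditions under which a point can be normalized by its frame and
  moved back again. They are stable under small changes of the point, as the domains are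
  open.\<close>

definition regular :: "real^'n \<Rightarrow> real^'m \<Rightarrow> bool" where
  "regular x u \<longleftrightarrow> x \<in> W \<and> (\<gamma> x, x) \<in> D \<and> (ginv (\<gamma> x), \<phi> (\<gamma> x) x) \<in> D \<and>
     (\<gamma> x, u) \<in> D' \<and> (ginv (\<gamma> x), \<psi> (\<gamma> x) u) \<in> D'"

lemma regular_space: "regular x u \<Longrightarrow> x \<in> X \<and> u \<in> U"
  using W_X input.domain_space by (auto simp: regular_def)

lemma eventually_regular:
  assumes "regular x1 u1"
  shows "\<forall>\<^sub>F z in nhds (x1, u1). regular (fst z) (snd z)"
proof -
  note x = tendsto_fst_nhds[of "(x1, u1)", unfolded fst_conv]
    and u = tendsto_snd_nhds[of "(x1, u1)", unfolded snd_conv]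
  have r: "x1 \<in> W" "(\<gamma> x1, x1) \<in> D" "(ginv (\<gamma> x1), \<phi> (\<gamma> x1) x1) \<in> D"
    "(\<gamma> x1, u1) \<in> D'" "(ginv (\<gamma> x1), \<psi> (\<gamma> x1) u1) \<in> D'"
    using assms by (auto simp: regular_def)
  note g = tendsto_frame[OF x r(1)]
  show ?thesis
    using eventually_in_open[OF x W_open r(1)] eventually_domain[OF g x r(2)]
      eventually_domain[OF tendsto_ginv[OF g] tendsto_action[OF g x r(2)] r(3)]
      input.eventually_domain[OF g u r(4)]
      input.eventually_domain[OF tendsto_ginv[OF g] input.tendsto_action[OF g u r(4)] r(5)]
    by eventually_elim (simp add: regular_def)
qed

lemma tendsto_frame_invariant:
  assumes "regular x1 u1" "(p \<longlongrightarrow> x1) A" "(q \<longlongrightarrow> u1) A"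
  shows "((\<lambda>z. J (p z, q z)) \<longlongrightarrow> J (x1, u1)) A"
  using assms unfolding frame_invariant_pack regular_def
  by (intro tendsto_pack tendsto_action input.tendsto_action tendsto_frame) auto

lemma smooth_on_frame_invariant:
  assumes "open V" "\<forall>z\<in>V. regular (fst z) (snd z)"
  shows "smooth_on V J"
proof -
  have x: "smooth_on V fst" and u: "smooth_on V snd"
    using assms(1) by (auto intro: smooth_on_bounded_linear bounded_linear_fst bounded_linear_snd)
  have W: "fst ` V \<subseteq> W"
    using assms(2) by (auto simp: regular_def)
  have "smooth_on V (\<lambda>z. \<phi> (\<gamma> (fst z)) (fst z))"
    using assms(2) by (intro smooth_on_action[OF assms(1) W_open frame_smooth x W x]) (simp add: regular_def)
  moreover have "smooth_on V (\<lambda>z. \<psi> (\<gamma> (fst z)) (snd z))"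
    using assms(2) by (intro input.smooth_on_action[OF assms(1) W_open frame_smooth x W u]) (simp add: regular_def)
  ultimately have "smooth_on V (\<lambda>z. pack \<beta> (\<phi> (\<gamma> (fst z)) (fst z)) (\<psi> (\<gamma> (fst z)) (snd z)))"
    by (rule smooth_on_pack[OF assms(1)])
  then show ?thesis
    by (simp flip: frame_invariant_pack)
qed

lemma frame_invariant_invariant:
  assumes "regular x1 u1" "(s \<longlongrightarrow> e) A" "(p \<longlongrightarrow> x1) A" "(q \<longlongrightarrow> u1) A"
  shows "\<forall>\<^sub>F z in A. J (\<phi> (s z) (p z), \<psi> (s z) (q z)) = J (p z, q z)"
proof -
  have r: "x1 \<in> W" "(\<gamma> x1, x1) \<in> D" "(\<gamma> x1, u1) \<in> D'"
    using assms(1) by (auto simp: regular_def)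
  show ?thesis
    using normalized_invariant[OF local_action_axioms r(1,2,2) assms(2,3,3)]
      normalized_invariant[OF input.local_action_axioms r(1,2,3) assms(2,3,4)]
    by eventually_elim (simp add: frame_invariant_pack)
qed

text \<open>A local right inverse of the frame invariant through the point \<open>(x, u)\<close> at which \<open>g = \<gamma>(x)\<close>.\<close>

definition slice :: "'g \<Rightarrow> real^'k \<Rightarrow> (real^'n) \<times> (real^'m)" where
  "slice g v = (\<phi> (ginv g) (unpack_state a c \<beta> v), \<psi> (ginv g) (unpack_input \<beta> v))"

text \<open>The components missing from \<open>J\<close> equal \<open>c\<close> by the normalization
  equation, so \<open>J\<close> determines the normalized state and input completely.\<close>

lemma unpack_frame_invariant:
  assumes "x \<in> W"
  shows "unpack_state a c \<beta> (J (x, u)) = \<phi> (\<gamma> x) x" "unpack_input \<beta> (J (x, u)) = \<psi> (\<gamma> x) u"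
  using unpack_state_pack[OF inj_a \<beta> comps_frame[OF assms]] unpack_input_pack[OF inj_a \<beta>]
  by (simp_all add: frame_invariant_pack)

lemma slice_frame_invariant:
  assumes "regular x u"
  shows "slice (\<gamma> x) (J (x, u)) = (x, u)"
  using assms unfolding slice_def regular_def
  by (simp add: unpack_frame_invariant action_ginv input.action_ginv)

lemma tendsto_slice:
  assumes "regular x1 u1" "(p \<longlongrightarrow> J (x1, u1)) A"
  shows "((\<lambda>z. slice (\<gamma> x1) (p z)) \<longlongrightarrow> (x1, u1)) A"
proof -
  have r: "x1 \<in> W" "(ginv (\<gamma> x1), unpack_state a c \<beta> (J (x1, u1))) \<in> D"
    "(ginv (\<gamma> x1), unpack_input \<beta> (J (x1, u1))) \<in> D'"
    using assms by (auto simp: regular_def unpack_frame_invariant)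
  have "((\<lambda>z. slice (\<gamma> x1) (p z)) \<longlongrightarrow> slice (\<gamma> x1) (J (x1, u1))) A"
    unfolding slice_def using assms(2) r
    by (intro tendsto_Pair tendsto_action input.tendsto_action tendsto_const
        tendsto_unpack_state tendsto_unpack_input) auto
  then show ?thesis
    by (simp add: slice_frame_invariant[OF assms(1)])
qed

lemma smooth_slice:
  assumes "regular x1 u1"
  obtains S where "open S" "J (x1, u1) \<in> S" "smooth_on S (slice (\<gamma> x1))"
proof -
  let ?g = "ginv (\<gamma> x1)"
  have r: "x1 \<in> W" "(?g, unpack_state a c \<beta> (J (x1, u1))) \<in> D"
    "(?g, unpack_input \<beta> (J (x1, u1))) \<in> D'"
    using assms by (auto simp: regular_def unpack_frame_invariant)
  have "\<forall>\<^sub>F v in nhds (J (x1, u1)). (?g, unpack_state a c \<beta> v) \<in> D \<and> (?g, unpack_input \<beta> v) \<in> D'"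
    by (intro eventually_conj eventually_domain[OF tendsto_const _ r(2)]
        input.eventually_domain[OF tendsto_const _ r(3)] tendsto_unpack_state tendsto_unpack_input filterlim_ident)
  from eventually_nhds_open[OF this] obtain S where S: "open S" "J (x1, u1) \<in> S"
    "\<forall>v\<in>S. (?g, unpack_state a c \<beta> v) \<in> D \<and> (?g, unpack_input \<beta> v) \<in> D'" .
  have "smooth_on S (slice (\<gamma> x1))"
    unfolding slice_def using S
    by (intro smooth_on_Pair smooth_on_action_fixed input.smooth_on_action_fixed
        smooth_on_unpack_state smooth_on_unpack_input) auto
  then show thesis
    using that S by blast
qed

text \<open>Applying \<open>\<gamma> x1\<close> to a state on the slice returns a vector whose
  components along \<open>a\<close> are \<open>c\<close>. Uniqueness in \<open>M\<close> shows that
  all nearby states on the slice have the frame \<open>\<gamma> x1\<close>, so \<open>J\<close>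
  recovers the packed coordinates.\<close>

lemma frame_invariant_slice:
  assumes "regular x1 u1"
  shows "\<forall>\<^sub>F v in nhds (J (x1, u1)). J (slice (\<gamma> x1) v) = v"
proof -
  let ?g = "\<gamma> x1" and ?l = "nhds (J (x1, u1))"
  have r: "x1 \<in> W" "(?g, x1) \<in> D" "(ginv ?g, \<phi> ?g x1) \<in> D" "(?g, u1) \<in> D'" "(ginv ?g, \<psi> ?g u1) \<in> D'"
    using assms by (auto simp: regular_def)
  have \<sigma>: "(unpack_state a c \<beta> \<longlongrightarrow> \<phi> ?g x1) ?l" and \<tau>: "(unpack_input \<beta> \<longlongrightarrow> \<psi> ?g u1) ?l"
    using tendsto_unpack_state[OF filterlim_ident] tendsto_unpack_input[OF filterlim_ident]
      unpack_frame_invariant[OF r(1)] by metis+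
  have sx: "((\<lambda>v. \<phi> (ginv ?g) (unpack_state a c \<beta> v)) \<longlongrightarrow> x1) ?l"
    and su: "((\<lambda>v. \<psi> (ginv ?g) (unpack_input \<beta> v)) \<longlongrightarrow> u1) ?l"
    using tendsto_fst[OF tendsto_slice[OF assms filterlim_ident]]
      tendsto_snd[OF tendsto_slice[OF assms filterlim_ident]] by (simp_all add: slice_def)
  show ?thesis
    using eventually_in_open[OF sx W_open r(1)]
      eventually_domain[OF tendsto_const \<sigma> r(3)] eventually_domain[OF tendsto_const sx r(2)]
      input.eventually_domain[OF tendsto_const \<tau> r(5)] input.eventually_domain[OF tendsto_const su r(4)]
  proof eventually_elim
    case (elim v)
    have x: "\<phi> ?g (\<phi> (ginv ?g) (unpack_state a c \<beta> v)) = unpack_state a c \<beta> v"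
      using action_gmul[OF elim(2,3)] e_domain action_e domain_space[OF elim(2)] by simp
    have u: "\<psi> ?g (\<psi> (ginv ?g) (unpack_input \<beta> v)) = unpack_input \<beta> v"
      using input.action_gmul[OF elim(4,5)] input.e_domain input.action_e input.domain_space[OF elim(4)]
      by simp
    have "\<gamma> (\<phi> (ginv ?g) (unpack_state a c \<beta> v)) = ?g"
      using frame_unique[OF elim(1) frame_M[OF r(1)]] x comps_unpack_state[OF inj_a \<beta>] by simp
    then show ?case
      by (simp add: slice_def frame_invariant_pack x u pack_unpack[OF inj_a \<beta>])
  qed
qed

lemma rank_frame_invariant:
  assumes "regular x1 u1"
  shows "rank_at J (x1, u1) = CARD('k)"
proof -
  let ?v = "J (x1, u1)"
  obtain V where V: "open V" "(x1, u1) \<in> V" "\<forall>z\<in>V. regular (fst z) (snd z)"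
    using eventually_nhds_open[OF eventually_regular[OF assms]] .
  have J': "(J has_derivative frechet_derivative J (at (x1, u1))) (at (slice (\<gamma> x1) ?v))"
    using smooth_on_has_derivative[OF smooth_on_frame_invariant[OF V(1,3)] V(2)]
    by (simp add: slice_frame_invariant[OF assms])
  obtain S where S: "open S" "?v \<in> S" "smooth_on S (slice (\<gamma> x1))"
    using smooth_slice[OF assms] .
  have "(J \<circ> slice (\<gamma> x1) has_derivative
      frechet_derivative J (at (x1, u1)) \<circ> frechet_derivative (slice (\<gamma> x1)) (at ?v)) (at ?v)"
    by (rule diff_chain_at[OF smooth_on_has_derivative[OF S(3,2)] J'])
  then have "((\<lambda>v. v) has_derivative
      frechet_derivative J (at (x1, u1)) \<circ> frechet_derivative (slice (\<gamma> x1)) (at ?v)) (at ?v)"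
    by (rule has_derivative_eventually_eq) (simp add: frame_invariant_slice[OF assms])
  then have "frechet_derivative J (at (x1, u1)) \<circ> frechet_derivative (slice (\<gamma> x1)) (at ?v) = (\<lambda>v. v)"
    using has_derivative_unique[OF _ has_derivative_ident] by metis
  then have "surj (frechet_derivative J (at (x1, u1)))"
    by (metis comp_apply surjI)
  then show ?thesis
    by (simp add: rank_at_def dim_UNIV)
qed

lemma full_rank_frame_invariant:
  assumes "regular x1 u1"
  shows "\<exists>V. (x1, u1) \<in> V \<and> V \<subseteq> X \<times> U \<and> full_rank_invariant_on e atlas \<phi> \<psi> V J"
proof -
  obtain V where V: "open V" "(x1, u1) \<in> V" "\<forall>z\<in>V. regular (fst z) (snd z)"
    using eventually_nhds_open[OF eventually_regular[OF assms]] .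
  have "\<forall>\<^sub>F (g, x, u) in nhds (e, x0, u0). J (\<phi> g x, \<psi> g u) = J (x, u)" if "(x0, u0) \<in> V" for x0 u0
  proof -
    have "regular x0 u0"
      using bspec[OF V(3) that] by simp
    then have "\<forall>\<^sub>F z in nhds (e, x0, u0).
        J (\<phi> (fst z) (fst (snd z)), \<psi> (fst z) (snd (snd z))) = J (fst (snd z), snd (snd z))"
      using tendsto_fst_nhds[of "(e, x0, u0)"] tendsto_fst[OF tendsto_snd_nhds[of "(e, x0, u0)"]]
        tendsto_snd[OF tendsto_snd_nhds[of "(e, x0, u0)"]]
      by (intro frame_invariant_invariant) (simp_all only: fst_conv snd_conv)
    then show ?thesis
      by (rule eventually_mono) auto
  qed
  moreover have "rank_at J z = CARD('n) + CARD('m) - CARD('r)" if "z \<in> V" for z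
    using rank_frame_invariant[of "fst z" "snd z"] bspec[OF V(3) that] card_invariants[OF inj_a \<beta>] by simp
  ultimately have "full_rank_invariant_on e atlas \<phi> \<psi> V J"
    unfolding full_rank_invariant_on_def using V(1) smooth_on_frame_invariant[OF V(1,3)] by auto
  moreover have "V \<subseteq> X \<times> U"
    using V(3) regular_space by auto
  ultimately show ?thesis
    using V(2) by blast
qed

section \<open>Comparison of the frame invariant with an arbitrary complete set of
  invariants\<close>

lemma frame_invariant_function_of:
  fixes I :: "(real^'n) \<times> (real^'m) \<Rightarrow> real^'k"
  assumes "regular x1 u1" "full_rank_invariant_on e atlas \<phi> \<psi> V I" "(x1, u1) \<in> V"
  obtains Q \<Theta> where "open Q" "I (x1, u1) \<in> Q" "smooth_on Q \<Theta>"
    "\<forall>\<^sub>F z in nhds (x1, u1). I z \<in> Q \<and> \<Theta> (I z) = J z"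
proof -
  let ?g = "\<gamma> x1" and ?v = "J (x1, u1)" and ?l = "nhds (x1, u1)"
  define A where "A v = I (slice ?g v)" for v
  have r: "x1 \<in> W" "(?g, x1) \<in> D" "(ginv ?g, \<phi> ?g x1) \<in> D" "(?g, u1) \<in> D'" "(ginv ?g, \<psi> ?g u1) \<in> D'"
    using assms by (auto simp: regular_def)
  have V: "open V" "smooth_on V I" "\<forall>\<^sub>F (g, x, u) in nhds (e, x1, u1). I (\<phi> g x, \<psi> g u) = I (x, u)"
    "rank_at I (x1, u1) = CARD('k)"
    using assms(2,3) card_invariants[OF inj_a \<beta>] by (auto simp: full_rank_invariant_on_def)
  note x = tendsto_fst_nhds[of "(x1, u1)", unfolded fst_conv]
    and u = tendsto_snd_nhds[of "(x1, u1)", unfolded snd_conv]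
  note s = tendsto_relative_frame[OF r(1) x]
  \<comment> \<open>The relative frame is close to \<open>e\<close>, so \<open>I\<close> keeps its
    value when \<open>z\<close> is moved by it, and the moved point is
    \<open>slice ?g (J z)\<close>.\<close>
  have IAJ: "\<forall>\<^sub>F z in ?l. I z = A (J z)"
    using eventually_nhds_tendsto[OF V(3) tendsto_Pair[OF s tendsto_Pair[OF x u]]]
      action_relative_frame[OF local_action_axioms r(1-3) x x]
      action_relative_frame[OF input.local_action_axioms r(1,4,5) x u]
      eventually_in_open[OF x W_open r(1)]
  proof eventually_elim
    case (elim z)
    then show ?case
      by (cases z) (simp add: A_def slice_def unpack_frame_invariant)
  qed
  obtain V1 where V1: "open V1" "(x1, u1) \<in> V1" "\<forall>z\<in>V1. regular (fst z) (snd z)"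
    using eventually_nhds_open[OF eventually_regular[OF assms(1)]] .
  note J' = smooth_on_has_derivative[OF smooth_on_frame_invariant[OF V1(1,3)] V1(2)]
  obtain S1 where S1: "open S1" "?v \<in> S1" "smooth_on S1 (slice ?g)"
    using smooth_slice[OF assms(1)] .
  have "\<forall>\<^sub>F v in nhds ?v. v \<in> S1 \<and> slice ?g v \<in> V"
    using eventually_nhds_in_open[OF S1(1,2)]
      eventually_in_open[OF tendsto_slice[OF assms(1) filterlim_ident] V(1) assms(3)]
    by eventually_elim simp
  from eventually_nhds_open[OF this]
  obtain S where S: "open S" "?v \<in> S" "\<forall>v\<in>S. v \<in> S1 \<and> slice ?g v \<in> V" .
  have A: "smooth_on S A"
    unfolding A_def using S by (intro smooth_on_compose[OF S(1) smooth_on_subset[OF S1(3)] V(2)]) auto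
  have "(A \<circ> J has_derivative frechet_derivative A (at ?v) \<circ> frechet_derivative J (at (x1, u1))) (at (x1, u1))"
    by (rule diff_chain_at[OF J' smooth_on_has_derivative[OF A S(2)]])
  then have "(I has_derivative frechet_derivative A (at ?v) \<circ> frechet_derivative J (at (x1, u1))) (at (x1, u1))"
    by (rule has_derivative_eventually_eq) (use IAJ in \<open>auto elim: eventually_mono\<close>)
  \<comment> \<open>The derivative of \<open>I\<close> factors through that of \<open>A\<close>, so
    its range is contained in the range of the latter. The rank of \<open>I\<close> already fills
    the target, which forces the derivative of \<open>A\<close> to be onto.\<close>
  from frechet_derivative_at[OF this, symmetric]
  have "range (frechet_derivative I (at (x1, u1))) \<subseteq> range (frechet_derivative A (at ?v))"
    by auto
  then have "CARD('k) \<le> dim (range (frechet_derivative A (at ?v)))"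
    using V(4) dim_subset unfolding rank_at_def by metis
  moreover have "subspace (range (frechet_derivative A (at ?v)))"
    using has_derivative_linear[OF smooth_on_has_derivative[OF A S(2)]] linear_subspace_image subspace_UNIV by blast
  ultimately have surj: "surj (frechet_derivative A (at ?v))"
    by (intro subspace_dim_equal) (auto simp: dim_UNIV)
  obtain P Q B where PQ: "open P" "?v \<in> P" "P \<subseteq> S" "open Q" "homeomorphism P Q A B" "smooth_on Q B"
    using smooth_inverse_function_theorem[OF S(1) A S(2) surj] .
  have "\<forall>\<^sub>F z in ?l. I z \<in> Q \<and> B (I z) = J z"
    using IAJ eventually_in_open[OF tendsto_frame_invariant[OF assms(1) x u] PQ(1,2)]
  proof eventually_elim
    case (elim z)
    then show ?case
      using PQ(5) by (auto simp: homeomorphism_def)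
  qed
  moreover from this have "I (x1, u1) \<in> Q"
    using eventually_nhds_x_imp_x by blast
  ultimately show thesis
    using that PQ(4,6) by blast
qed

end

subsection \<open>Error dynamics\<close>

lemma has_vector_derivative_Pair:
  assumes "(f has_vector_derivative f') (at t within T)" "(g has_vector_derivative g') (at t within T)"
  shows "((\<lambda>s. (f s, g s)) has_vector_derivative (f', g')) (at t within T)"
  using has_derivative_Pair[OF assms[unfolded has_vector_derivative_def]]
  by (simp add: has_vector_derivative_def)

section \<open>Invariance of the state error and of its derivative\<close>

context moving_frame
begin

definition err :: "(real^'n) \<times> (real^'n) \<Rightarrow> real^'n" where
  "err z = state_error \<phi> \<gamma> (fst z) (snd z)"

text \<open>The error involves only the action of the frame itself; moving back by its inverse
  enters later, when the rate is expressed on the slice.\<close>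

definition error_regular :: "(real^'n) \<times> (real^'n) \<Rightarrow> bool" where
  "error_regular z \<longleftrightarrow> fst z \<in> W \<and> (\<gamma> (fst z), fst z) \<in> D \<and> (\<gamma> (fst z), snd z) \<in> D"

lemma eventually_error_regular:
  assumes "error_regular z1" "(p \<longlongrightarrow> z1) A"
  shows "\<forall>\<^sub>F z in A. error_regular (p z)"
proof -
  note r = assms(1)[unfolded error_regular_def]
  note x = tendsto_fst[OF assms(2)] and xh = tendsto_snd[OF assms(2)]
  note g = tendsto_frame[OF x conjunct1[OF r]]
  show ?thesis
    unfolding error_regular_def using r
    by (intro eventually_conj eventually_in_open[OF x W_open] eventually_domain[OF g x]
        eventually_domain[OF g xh]) auto
qed

lemma tendsto_err:
  assumes "error_regular z1" "(p \<longlongrightarrow> z1) A"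
  shows "((\<lambda>z. err (p z)) \<longlongrightarrow> err z1) A"
proof -
  note r = assms(1)[unfolded error_regular_def]
  note x = tendsto_fst[OF assms(2)] and xh = tendsto_snd[OF assms(2)]
  note g = tendsto_frame[OF x conjunct1[OF r]]
  show ?thesis
    unfolding err_def state_error_def using r
    by (intro tendsto_diff tendsto_action[OF g x] tendsto_action[OF g xh]) auto
qed

lemma smooth_on_err:
  assumes "open E" "\<forall>z\<in>E. error_regular z"
  shows "smooth_on E err"
proof -
  have x: "smooth_on E fst" and xh: "smooth_on E snd"
    using assms(1) by (auto intro: smooth_on_bounded_linear bounded_linear_fst bounded_linear_snd)
  have W: "fst ` E \<subseteq> W"
    using assms(2) by (auto simp: error_regular_def)
  show ?thesis
    unfolding err_def state_error_def using assms
    by (intro smooth_on_diff smooth_on_action[OF assms(1) W_open frame_smooth x W xh]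
        smooth_on_action[OF assms(1) W_open frame_smooth x W x]) (auto simp: error_regular_def)
qed

lemma err_has_derivative:
  assumes "error_regular z"
  shows "(err has_derivative frechet_derivative err (at z)) (at z)"
proof -
  obtain E where E: "open E" "z \<in> E" "\<forall>y\<in>E. error_regular y"
    using eventually_nhds_open[OF eventually_error_regular[OF assms filterlim_ident]] .
  show ?thesis
    using smooth_on_has_derivative[OF smooth_on_err[OF E(1,3)] E(2)] .
qed

lemma err_invariant:
  assumes "error_regular (x1, xh1)" "(s \<longlongrightarrow> e) A" "(p \<longlongrightarrow> x1) A" "(q \<longlongrightarrow> xh1) A"
  shows "\<forall>\<^sub>F z in A. err (\<phi> (s z) (p z), \<phi> (s z) (q z)) = err (p z, q z)"
proof -
  have r: "x1 \<in> W" "(\<gamma> x1, x1) \<in> D" "(\<gamma> x1, xh1) \<in> D"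
    using assms(1) by (auto simp: error_regular_def)
  show ?thesis
    using normalized_invariant[OF local_action_axioms r(1,2,2) assms(2,3,3)]
      normalized_invariant[OF local_action_axioms r(1,2,3) assms(2,3,4)]
    by eventually_elim (simp add: err_def state_error_def)
qed

text \<open>For each \<open>z\<close> the group element is frozen at \<open>s z\<close>, and the
  chain rule is applied to the invariance of \<open>err\<close> as an identity in the two
  states.\<close>

lemma err_derivative_invariant:
  assumes "error_regular (x1, xh1)" "(s \<longlongrightarrow> e) A" "(p \<longlongrightarrow> x1) A" "(q \<longlongrightarrow> xh1) A"
  shows "\<forall>\<^sub>F z in A. \<forall>v w. frechet_derivative err (at (\<phi> (s z) (p z), \<phi> (s z) (q z)))
      (frechet_derivative (\<phi> (s z)) (at (p z)) v, frechet_derivative (\<phi> (s z)) (at (q z)) w) =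
    frechet_derivative err (at (p z, q z)) (v, w)"
proof -
  have x1: "x1 \<in> X" and xh1: "xh1 \<in> X"
    using assms(1) domain_space by (auto simp: error_regular_def)
  have "\<forall>\<^sub>F z in nhds (e, x1, xh1). err (\<phi> (fst z) (fst (snd z)), \<phi> (fst z) (snd (snd z))) = err (snd z)"
    using err_invariant[OF assms(1), of fst "nhds (e, x1, xh1)" "\<lambda>z. fst (snd z)" "\<lambda>z. snd (snd z)"]
      tendsto_fst_nhds[of "(e, x1, xh1)"] tendsto_fst[OF tendsto_snd_nhds[of "(e, x1, xh1)"]]
      tendsto_snd[OF tendsto_snd_nhds[of "(e, x1, xh1)"]]
    by (simp only: fst_conv snd_conv prod.collapse)
  \<comment> \<open>Differentiating at \<open>(p z, q z)\<close> takes the identity on a whole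
    neighbourhood of that point; \<open>eventually_eventually\<close> provides this for all
    \<open>z\<close> far along the filter.\<close>
  from eventually_nhds_tendsto[OF iffD2[OF eventually_eventually this]
      tendsto_Pair[OF assms(2) tendsto_Pair[OF assms(3,4)]]]
  have inv: "\<forall>\<^sub>F z in A. \<forall>\<^sub>F y in nhds (s z, p z, q z).
      err (\<phi> (fst y) (fst (snd y)), \<phi> (fst y) (snd (snd y))) = err (snd y)" .
  have "((\<lambda>z. (\<phi> (s z) (p z), \<phi> (s z) (q z))) \<longlongrightarrow> (x1, xh1)) A"
    using tendsto_Pair[OF tendsto_action[OF assms(2,3) e_domain[OF x1]]
        tendsto_action[OF assms(2,4) e_domain[OF xh1]]] x1 xh1 by (simp add: action_e)
  note reg = eventually_error_regular[OF assms(1) this]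
    eventually_error_regular[OF assms(1) tendsto_Pair[OF assms(3,4)]]
  show ?thesis
    using inv reg eventually_domain[OF assms(2,3) e_domain[OF x1]]
      eventually_domain[OF assms(2,4) e_domain[OF xh1]]
  proof eventually_elim
    case (elim z)
    have "((\<lambda>y. (s z, y)) \<longlongrightarrow> (s z, p z, q z)) (nhds (p z, q z))"
      by (intro tendsto_Pair tendsto_const filterlim_ident)
    from eventually_nhds_tendsto[OF elim(1) this]
    have ev: "\<forall>\<^sub>F y in nhds (p z, q z). err (\<phi> (s z) (fst y), \<phi> (s z) (snd y)) = err y"
      by (simp only: fst_conv snd_conv)
    have "((\<lambda>y. (\<phi> (s z) (fst y), \<phi> (s z) (snd y))) has_derivative
        (\<lambda>v. (frechet_derivative (\<phi> (s z)) (at (p z)) (fst v),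
          frechet_derivative (\<phi> (s z)) (at (q z)) (snd v)))) (at (p z, q z))"
      using has_derivative_compose[OF has_derivative_fst[OF has_derivative_ident[of "at (p z, q z)"]], of "\<phi> (s z)"]
        has_derivative_compose[OF has_derivative_snd[OF has_derivative_ident[of "at (p z, q z)"]], of "\<phi> (s z)"]
        action_has_derivative[OF elim(4)] action_has_derivative[OF elim(5)]
      by (intro has_derivative_Pair) auto
    from has_derivative_compose[OF this, of err] err_has_derivative[OF elim(2)]
    have "((\<lambda>y. err (\<phi> (s z) (fst y), \<phi> (s z) (snd y))) has_derivative
        (\<lambda>v. frechet_derivative err (at (\<phi> (s z) (p z), \<phi> (s z) (q z)))
          (frechet_derivative (\<phi> (s z)) (at (p z)) (fst v),
           frechet_derivative (\<phi> (s z)) (at (q z)) (snd v)))) (at (p z, q z))"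
      by (simp only: fst_conv snd_conv)
    from has_derivative_eventually_eq[OF this ev]
    have "(err has_derivative
        (\<lambda>v. frechet_derivative err (at (\<phi> (s z) (p z), \<phi> (s z) (q z)))
          (frechet_derivative (\<phi> (s z)) (at (p z)) (fst v),
           frechet_derivative (\<phi> (s z)) (at (q z)) (snd v)))) (at (p z, q z))"
      by simp
    note eq = has_derivative_unique[OF this err_has_derivative[OF elim(3)]]
    show ?case
    proof (intro allI)
      fix v w
      show "frechet_derivative err (at (\<phi> (s z) (p z), \<phi> (s z) (q z)))
          (frechet_derivative (\<phi> (s z)) (at (p z)) v, frechet_derivative (\<phi> (s z)) (at (q z)) w) =
        frechet_derivative err (at (p z, q z)) (v, w)"
        using fun_cong[OF eq, of "(v, w)"] by simp
    qed
  qed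
qed

end

section \<open>The rate of the error as a function of the error and the invariants\<close>

context framed_actions
begin

lemma autonomous_error:
  fixes f :: "real^'n \<Rightarrow> real^'m \<Rightarrow> real^'n" and h :: "real^'n \<Rightarrow> real^'m \<Rightarrow> real^'p"
    and F :: "real^'n \<Rightarrow> real^'m \<Rightarrow> real^'p \<Rightarrow> real^'n" and I :: "(real^'n) \<times> (real^'m) \<Rightarrow> real^'k"
  assumes "open X" "open U" "open Y"
    and f: "smooth_on (X \<times> U) (\<lambda>(x, u). f x u)" "invariant_system e \<phi> \<psi> X U f"
    and h: "smooth_on (X \<times> U) (\<lambda>(x, u). h x u)" "\<forall>x\<in>X. \<forall>u\<in>U. h x u \<in> Y"
      "equivariant_output e \<phi> \<psi> \<rho> X U h"
    and F: "invariant_pre_observer e \<phi> \<psi> \<rho> X U Y f h F"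
    and reg: "regular x1 u1" "(\<gamma> x1, xh1) \<in> D" "(ginv (\<gamma> x1), \<phi> (\<gamma> x1) xh1) \<in> D"
    and I: "full_rank_invariant_on e atlas \<phi> \<psi> V I" "(x1, u1) \<in> V"
  shows "autonomous_error_dynamics f h F (state_error \<phi> \<gamma>) I x1 xh1 u1"
proof -
  let ?g = "\<gamma> x1" and ?l = "nhds (x1, xh1, u1)" and ?\<sigma> = "unpack_state a c \<beta>" and ?\<tau> = "unpack_input \<beta>"
  \<comment> \<open>This is the time derivative of the error along solutions of the coupled
    system.\<close>
  define G where "G x xh u = frechet_derivative err (at (x, xh)) (f x u, F xh u (h x u))" for x xh u
  have r: "x1 \<in> W" "(?g, x1) \<in> D" "(ginv ?g, \<phi> ?g x1) \<in> D" "(?g, u1) \<in> D'" "(ginv ?g, \<psi> ?g u1) \<in> D'"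
    using reg(1) by (auto simp: regular_def)
  have pts: "x1 \<in> X" "xh1 \<in> X" "u1 \<in> U" "h x1 u1 \<in> Y"
    using regular_space[OF reg(1)] domain_space[OF reg(2)] h(2) by auto
  have er: "error_regular (x1, xh1)"
    using r reg(2) by (simp add: error_regular_def)
  have x: "(fst \<longlongrightarrow> x1) ?l"
    using tendsto_fst_nhds[of "(x1, xh1, u1)"] by (simp only: fst_conv)
  have xh: "((\<lambda>z. fst (snd z)) \<longlongrightarrow> xh1) ?l"
    using tendsto_fst[OF tendsto_snd_nhds[of "(x1, xh1, u1)"]] by (simp only: fst_conv snd_conv)
  have u: "((\<lambda>z. snd (snd z)) \<longlongrightarrow> u1) ?l"
    using tendsto_snd[OF tendsto_snd_nhds[of "(x1, xh1, u1)"]] by (simp only: fst_conv snd_conv)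
  note s = tendsto_relative_frame[OF r(1) x]
  have y: "((\<lambda>z. h (fst z) (snd (snd z))) \<longlongrightarrow> h x1 u1) ?l"
    using tendsto_continuous_on[OF smooth_on_imp_continuous_on[OF h(1)] open_Times[OF assms(1,2)]
        tendsto_Pair[OF x u]] pts by simp
  have F': "smooth_on (X \<times> U \<times> Y) (\<lambda>(x, u, y). F x u y)"
    "\<forall>\<^sub>F (g, x, u, y) in nhds (e, xh1, u1, h x1 u1).
        F (\<phi> g x) (\<psi> g u) (\<rho> g y) = frechet_derivative (\<phi> g) (at x) (F x u y)"
    using F pts by (auto simp: invariant_pre_observer_def pre_observer_def)
  have f': "\<forall>\<^sub>F (g, x, u) in nhds (e, x1, u1). f (\<phi> g x) (\<psi> g u) = frechet_derivative (\<phi> g) (at x) (f x u)"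
    using f(2) pts by (simp add: invariant_system_def)
  have h': "\<forall>\<^sub>F (g, x, u) in nhds (e, x1, u1). h (\<phi> g x) (\<psi> g u) = \<rho> g (h x u)"
    using h(3) pts by (simp add: equivariant_output_def)
  \<comment> \<open>The rate evaluated on the slice: \<open>fst y\<close> stands for the error and
    \<open>snd y\<close> for the value of \<open>J\<close>. The normalized state, the normalized
    estimate (their sum) and the normalized input are all moved back by
    \<open>ginv ?g\<close>.\<close>
  define K where "K y = G (\<phi> (ginv ?g) (?\<sigma> (snd y))) (\<phi> (ginv ?g) (fst y + ?\<sigma> (snd y)))
    (\<psi> (ginv ?g) (?\<tau> (snd y)))" for y
  have G_K: "\<forall>\<^sub>F z in ?l. G (fst z) (fst (snd z)) (snd (snd z)) = K (err (fst z, fst (snd z)), J (fst z, snd (snd z)))"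
    using eventually_nhds_tendsto[OF f' tendsto_Pair[OF s tendsto_Pair[OF x u]]]
      eventually_nhds_tendsto[OF h' tendsto_Pair[OF s tendsto_Pair[OF x u]]]
      eventually_nhds_tendsto[OF F'(2) tendsto_Pair[OF s tendsto_Pair[OF xh tendsto_Pair[OF u y]]]]
      err_derivative_invariant[OF er s x xh]
      action_relative_frame[OF local_action_axioms r(1-3) x x]
      action_relative_frame[OF local_action_axioms r(1) reg(2,3) x xh]
      action_relative_frame[OF input.local_action_axioms r(1,4,5) x u]
      eventually_in_open[OF x W_open r(1)]
  proof eventually_elim
    case (elim z)
    let ?s = "gmul (ginv ?g) (\<gamma> (fst z))"
    \<comment> \<open>Equivariance of \<open>h\<close> brings the output argument of
      \<open>F\<close> into the form that its invariance requires. Both velocities are then images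
      under the derivative of \<open>\<phi> ?s\<close>, which the invariance of the derivative of
      \<open>err\<close> absorbs.\<close>
    have "G (\<phi> ?s (fst z)) (\<phi> ?s (fst (snd z))) (\<psi> ?s (snd (snd z))) = G (fst z) (fst (snd z)) (snd (snd z))"
      using elim(1-4) by (simp add: G_def)
    then show ?case
      using elim(5-8) by (simp add: K_def unpack_frame_invariant err_def state_error_def)
  qed
  obtain E where E: "open E" "(x1, xh1) \<in> E" "\<forall>z\<in>E. error_regular z"
    using eventually_nhds_open[OF eventually_error_regular[OF er filterlim_ident]] .
  let ?y = "(err (x1, xh1), J (x1, u1))"
  \<comment> \<open>At \<open>?y\<close> the rate is evaluated at \<open>x1\<close>,
    \<open>xh1\<close>, \<open>u1\<close>. For \<open>y\<close> near \<open>?y\<close> the arguments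
    remain in the action domains and the pair of states remains in \<open>E\<close>, where
    \<open>err\<close> is smooth.\<close>
  have "\<exists>S. open S \<and> ?y \<in> S \<and> smooth_on S K"
  proof -
    let ?k = "nhds ?y"
    define px where "px y = \<phi> (ginv ?g) (?\<sigma> (snd y))" for y :: "(real^'n) \<times> (real^'k)"
    define pxh where "pxh y = \<phi> (ginv ?g) (fst y + ?\<sigma> (snd y))" for y
    define pu where "pu y = \<psi> (ginv ?g) (?\<tau> (snd y))" for y :: "(real^'n) \<times> (real^'k)"
    have \<sigma>: "((\<lambda>y. ?\<sigma> (snd y)) \<longlongrightarrow> \<phi> ?g x1) ?k" and \<tau>: "((\<lambda>y. ?\<tau> (snd y)) \<longlongrightarrow> \<psi> ?g u1) ?k"
      using tendsto_unpack_state[OF tendsto_snd_nhds[of ?y], of a c \<beta>]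
        tendsto_unpack_input[OF tendsto_snd_nhds[of ?y], of \<beta>]
      by (simp_all only: snd_conv unpack_frame_invariant[OF r(1)])
    have \<eta>: "((\<lambda>y. fst y + ?\<sigma> (snd y)) \<longlongrightarrow> \<phi> ?g xh1) ?k"
      using tendsto_add[OF tendsto_fst_nhds[of ?y] \<sigma>] by (simp add: err_def state_error_def)
    have px: "(px \<longlongrightarrow> x1) ?k"
      unfolding px_def using tendsto_action[OF tendsto_const \<sigma> r(3)] action_ginv[OF r(2,3)] by simp
    have pxh: "(pxh \<longlongrightarrow> xh1) ?k"
      unfolding pxh_def using tendsto_action[OF tendsto_const \<eta> reg(3)] action_ginv[OF reg(2,3)] by simp
    have "\<forall>\<^sub>F y in ?k. (ginv ?g, ?\<sigma> (snd y)) \<in> D \<and> (ginv ?g, fst y + ?\<sigma> (snd y)) \<in> D \<and>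
        (ginv ?g, ?\<tau> (snd y)) \<in> D' \<and> (px y, pxh y) \<in> E"
      by (intro eventually_conj eventually_domain[OF tendsto_const \<sigma> r(3)]
          eventually_domain[OF tendsto_const \<eta> reg(3)] input.eventually_domain[OF tendsto_const \<tau> r(5)]
          eventually_in_open[OF tendsto_Pair[OF px pxh] E(1,2)])
    from eventually_nhds_open[OF this] obtain S where S: "open S" "?y \<in> S" and SD: "\<forall>y\<in>S. (ginv ?g, ?\<sigma> (snd y)) \<in> D \<and>
        (ginv ?g, fst y + ?\<sigma> (snd y)) \<in> D \<and> (ginv ?g, ?\<tau> (snd y)) \<in> D' \<and> (px y, pxh y) \<in> E"
      .
    have D: "(ginv ?g, ?\<sigma> (snd y)) \<in> D" "(ginv ?g, fst y + ?\<sigma> (snd y)) \<in> D"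
      "(ginv ?g, ?\<tau> (snd y)) \<in> D'" and SE: "(px y, pxh y) \<in> E" if "y \<in> S" for y
      using bspec[OF SD that] by auto
    have fst: "smooth_on S fst" and snd: "smooth_on S snd"
      using S(1) by (auto intro: smooth_on_bounded_linear bounded_linear_fst bounded_linear_snd)
    have \<sigma>': "smooth_on S (\<lambda>y. ?\<sigma> (snd y))"
      by (rule smooth_on_compose[OF S(1) snd smooth_on_unpack_state[OF open_UNIV]]) simp
    have \<tau>': "smooth_on S (\<lambda>y. ?\<tau> (snd y))"
      by (rule smooth_on_compose[OF S(1) snd smooth_on_unpack_input[OF open_UNIV]]) simp
    have px': "smooth_on S px"
      unfolding px_def by (rule smooth_on_action_fixed[OF S(1) \<sigma>' D(1)])
    have pxh': "smooth_on S pxh"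
      unfolding pxh_def by (rule smooth_on_action_fixed[OF S(1) smooth_on_add[OF S(1) fst \<sigma>'] D(2)])
    have pu': "smooth_on S pu"
      unfolding pu_def by (rule input.smooth_on_action_fixed[OF S(1) \<tau>' D(3)])
    have mem: "px y \<in> X" "pxh y \<in> X" "pu y \<in> U" if "y \<in> S" for y
      unfolding px_def pxh_def pu_def
      using D[OF that] action_closed input.action_closed by auto
    have XU: "(\<lambda>y. (px y, pu y)) ` S \<subseteq> X \<times> U"
      using mem by auto
    have hy: "smooth_on S (\<lambda>y. h (px y) (pu y))"
      using smooth_on_compose[OF S(1) smooth_on_Pair[OF S(1) px' pu'] h(1) XU] by (simp only: prod.case)
    have fy: "smooth_on S (\<lambda>y. f (px y) (pu y))"
      using smooth_on_compose[OF S(1) smooth_on_Pair[OF S(1) px' pu'] f(1) XU] by (simp only: prod.case)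
    have XUY: "(\<lambda>y. (pxh y, pu y, h (px y) (pu y))) ` S \<subseteq> X \<times> U \<times> Y"
      using mem h(2) by auto
    have Fy: "smooth_on S (\<lambda>y. F (pxh y) (pu y) (h (px y) (pu y)))"
      using smooth_on_compose[OF S(1) smooth_on_Pair[OF S(1) pxh' smooth_on_Pair[OF S(1) pu' hy]] F'(1) XUY]
      by (simp only: prod.case)
    have "smooth_on S (\<lambda>y. frechet_derivative err (at (px y, pxh y))
        (f (px y) (pu y), F (pxh y) (pu y) (h (px y) (pu y))))"
      by (rule smooth_on_frechet_derivative_apply[OF E(1) S(1) smooth_on_err[OF E(1,3)]
            smooth_on_Pair[OF S(1) px' pxh'] _ smooth_on_Pair[OF S(1) fy Fy]]) (use SE in auto)
    moreover have "K = (\<lambda>y. frechet_derivative err (at (px y, pxh y))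
        (f (px y) (pu y), F (pxh y) (pu y) (h (px y) (pu y))))"
      by (simp add: K_def G_def px_def pxh_def pu_def fun_eq_iff)
    ultimately show ?thesis
      using S by auto
  qed
  then obtain S where S: "open S" "?y \<in> S" "smooth_on S K"
    by blast
  obtain Q \<Theta> where Q: "open Q" "I (x1, u1) \<in> Q" "smooth_on Q \<Theta>"
    and \<Theta>: "\<forall>\<^sub>F z in nhds (x1, u1). I z \<in> Q \<and> \<Theta> (I z) = J z"
    using frame_invariant_function_of[OF reg(1) I] .
  \<comment> \<open>On \<open>R\<close> the vector \<open>\<Theta> (snd y)\<close> replaces the
    value of \<open>I\<close> by that of \<open>J\<close>, and the resulting pair lies where
    \<open>K\<close> is smooth. The composite is the \<open>\<Upsilon>\<close> supplied at the
    end.\<close>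
  define R where "R = (UNIV \<times> Q) \<inter> (\<lambda>y. (fst y, \<Theta> (snd y))) -` S"
  have cont: "smooth_on (UNIV \<times> Q) (\<lambda>y :: (real^'n) \<times> (real^'k). (fst y, \<Theta> (snd y)))"
  proof (rule smooth_on_Pair)
    show o: "open (UNIV \<times> Q :: ((real^'n) \<times> (real^'k)) set)"
      using Q(1) by (intro open_Times) auto
    show "smooth_on (UNIV \<times> Q) (fst :: (real^'n) \<times> (real^'k) \<Rightarrow> real^'n)"
      by (rule smooth_on_bounded_linear[OF o bounded_linear_fst])
    show "smooth_on (UNIV \<times> Q) (\<lambda>y :: (real^'n) \<times> (real^'k). \<Theta> (snd y))"
      by (rule smooth_on_compose[OF o smooth_on_bounded_linear[OF o bounded_linear_snd] Q(3)]) auto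
  qed
  have R: "open R" "smooth_on R (\<lambda>y. K (fst y, \<Theta> (snd y)))"
  proof -
    show "open R"
      unfolding R_def
      by (rule continuous_open_preimage[OF smooth_on_imp_continuous_on[OF cont] open_Times[OF open_UNIV Q(1)] S(1)])
    then show "smooth_on R (\<lambda>y. K (fst y, \<Theta> (snd y)))"
      by (rule smooth_on_compose[OF _ smooth_on_subset[OF cont] S(3)]) (auto simp: R_def)
  qed
  have "\<forall>\<^sub>F z in ?l. (fst z, fst (snd z)) \<in> E \<and>
      (err (fst z, fst (snd z)), I (fst z, snd (snd z))) \<in> R \<and>
      G (fst z) (fst (snd z)) (snd (snd z)) = K (err (fst z, fst (snd z)), \<Theta> (I (fst z, snd (snd z))))"
    using G_K eventually_nhds_tendsto[OF \<Theta> tendsto_Pair[OF x u]]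
      eventually_in_open[OF tendsto_Pair[OF x xh] E(1,2)]
      eventually_in_open[OF tendsto_Pair[OF tendsto_err[OF er tendsto_Pair[OF x xh]]
        tendsto_frame_invariant[OF reg(1) x u]] S(1,2)]
    by eventually_elim (auto simp: R_def)
  from eventually_nhds_open[OF this] obtain \<Omega> where \<Omega>: "open \<Omega>" "(x1, xh1, u1) \<in> \<Omega>" "\<forall>z\<in>\<Omega>. (fst z, fst (snd z)) \<in> E \<and>
      (err (fst z, fst (snd z)), I (fst z, snd (snd z))) \<in> R \<and>
      G (fst z) (fst (snd z)) (snd (snd z)) = K (err (fst z, fst (snd z)), \<Theta> (I (fst z, snd (snd z))))"
    .
  have "((\<lambda>s. state_error \<phi> \<gamma> (x s) (xh s)) has_vector_derivative
      K (state_error \<phi> \<gamma> (x t) (xh t), \<Theta> (I (x t, u t)))) (at t within T)"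
    if "solution_in f h F \<Omega> T x xh u" "t \<in> T" for T x xh u t
  proof -
    have sol: "(x t, xh t, u t) \<in> \<Omega>" "(x has_vector_derivative f (x t) (u t)) (at t within T)"
      "(xh has_vector_derivative F (xh t) (u t) (h (x t) (u t))) (at t within T)"
      using that by (auto simp: solution_in_def)
    have "(err has_derivative frechet_derivative err (at (x t, xh t))) (at (x t, xh t))"
      using err_has_derivative E(3) bspec[OF \<Omega>(3) sol(1)] by simp
    \<comment> \<open>The input enters the rate only through the two velocities, so the chain rule
      is applied to the pair of states alone.\<close>
    then have "((err \<circ> (\<lambda>s. (x s, xh s))) has_vector_derivative
        G (x t) (xh t) (u t)) (at t within T)"
      unfolding G_def
      by (intro vector_derivative_diff_chain_within[OF has_vector_derivative_Pair[OF sol(2,3)]])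
        (rule has_derivative_at_withinI)
    then show ?thesis
      using bspec[OF \<Omega>(3) sol(1)] by (simp add: o_def err_def)
  qed
  then show ?thesis
    unfolding autonomous_error_dynamics_def
    using R \<Omega>
    by (intro exI[of _ "\<lambda>y. K (fst y, \<Theta> (snd y))"] exI[of _ R] exI[of _ \<Omega>]) (auto simp: err_def)
qed

end

section \<open>Choice of the neighbourhood of the identity and assembly of the results\<close>

theorem theorem3:
  fixes gmul :: "'g::{t2_space, second_countable_topology} \<Rightarrow> 'g \<Rightarrow> 'g"
    and e :: 'g and ginv :: "'g \<Rightarrow> 'g"
    and atlas :: "('g set \<times> ('g \<Rightarrow> real^'r)) set"
    and X :: "(real^'n) set" and U :: "(real^'m) set" and Y :: "(real^'p) set"
    and \<phi> :: "'g \<Rightarrow> real^'n \<Rightarrow> real^'n"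
    and \<psi> :: "'g \<Rightarrow> real^'m \<Rightarrow> real^'m"
    and \<rho> :: "'g \<Rightarrow> real^'p \<Rightarrow> real^'p"
    and f :: "real^'n \<Rightarrow> real^'m \<Rightarrow> real^'n"
    and h :: "real^'n \<Rightarrow> real^'m \<Rightarrow> real^'p"
    and F :: "real^'n \<Rightarrow> real^'m \<Rightarrow> real^'p \<Rightarrow> real^'n"
    and a :: "'r \<Rightarrow> 'n" and \<beta> :: "'k::finite \<Rightarrow> 'n + 'm"
    and x0 xh0 :: "real^'n" and u0 :: "real^'m"
  assumes "lie_group gmul e ginv atlas"
    and "CARD('r) \<le> CARD('n)" and "CARD('p) \<le> CARD('n)"
    and "open X" and "open U" and "open Y"
    and "smooth_on (X \<times> U) (\<lambda>(x, u). f x u)"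
    and "smooth_on (X \<times> U) (\<lambda>(x, u). h x u)"
    and "\<forall>x\<in>X. \<forall>u\<in>U. h x u \<in> Y"
    and "local_transformation_group gmul e atlas X \<phi>"
    and "local_transformation_group gmul e atlas U \<psi>"
    and "local_transformation_group gmul e atlas Y \<rho>"
    and "full_rank_action e atlas X \<phi>"
    and "invariant_system e \<phi> \<psi> X U f"
    and "equivariant_output e \<phi> \<psi> \<rho> X U h"
    and "invariant_pre_observer e \<phi> \<psi> \<rho> X U Y f h F"
    and "x0 \<in> X" and "xh0 \<in> X" and "u0 \<in> U"
    and "admissible_splitting e atlas \<phi> a x0"
    and "bij_betw \<beta> UNIV ((- range a) <+> UNIV)"
  shows "\<exists>N. open N \<and> e \<in> N \<and>
    (\<forall>c W \<gamma>. moving_frame_on atlas \<phi> a c W \<gamma> \<and> W \<subseteq> X \<and> x0 \<in> W \<and> \<gamma> x0 \<in> N \<longrightarrow>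
      (\<exists>V. (x0, u0) \<in> V \<and> V \<subseteq> X \<times> U \<and> full_rank_invariant_on e atlas \<phi> \<psi> V (frame_invariant \<phi> \<psi> \<gamma> \<beta>)) \<and>
      (\<forall>V (I :: (real^'n) \<times> (real^'m) \<Rightarrow> real^'k).
        (x0, u0) \<in> V \<and> V \<subseteq> X \<times> U \<and> full_rank_invariant_on e atlas \<phi> \<psi> V I \<longrightarrow>
        autonomous_error_dynamics f h F (state_error \<phi> \<gamma>) I x0 xh0 u0))"
proof -
  obtain D where "local_action gmul e ginv atlas X D \<phi>"
    using local_transformation_group_action[OF assms(1,10)] .
  then interpret state: local_action gmul e ginv atlas X D \<phi> .
  obtain D' where "local_action gmul e ginv atlas U D' \<psi>"
    using local_transformation_group_action[OF assms(1,11)] .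
  then interpret input: local_action gmul e ginv atlas U D' \<psi> .
  have inj: "inj a"
    using assms(20) by (simp add: admissible_splitting_def)
  have ginv_e: "ginv e = e"
    using state.right_inverse state.group_left_neutral by metis
  note g = filterlim_ident[of "nhds e"] and e = state.e_domain[OF assms(17)] state.e_domain[OF assms(18)]
    input.e_domain[OF assms(19)]
  have act_e: "\<phi> e x0 = x0" "\<phi> e xh0 = xh0" "\<psi> e u0 = u0"
    using state.action_e[OF assms(17)] state.action_e[OF assms(18)] input.action_e[OF assms(19)] .
  \<comment> \<open>All six memberships hold at \<open>e\<close>, which acts as the identity, and
    they persist nearby because the domains are open. The neighbourhood depends only on the base
    points and the actions, so it can be chosen before the frame; \<open>\<gamma> x0 \<in> N\<close>
    then yields the domain conditions at the base points.\<close>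
  have "\<forall>\<^sub>F g in nhds e. (g, x0) \<in> D \<and> (g, xh0) \<in> D \<and> (g, u0) \<in> D' \<and>
      (ginv g, \<phi> g x0) \<in> D \<and> (ginv g, \<phi> g xh0) \<in> D \<and> (ginv g, \<psi> g u0) \<in> D'"
    using state.eventually_domain[OF g tendsto_const e(1)] state.eventually_domain[OF g tendsto_const e(2)]
      input.eventually_domain[OF g tendsto_const e(3)]
      state.eventually_domain[OF state.tendsto_ginv[OF g] state.tendsto_action[OF g tendsto_const e(1)]]
      state.eventually_domain[OF state.tendsto_ginv[OF g] state.tendsto_action[OF g tendsto_const e(2)]]
      input.eventually_domain[OF state.tendsto_ginv[OF g] input.tendsto_action[OF g tendsto_const e(3)]]
      e
    unfolding act_e ginv_e by (simp add: eventually_conj_iff)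
  from eventually_nhds_open[OF this] obtain N where N: "open N" "e \<in> N"
    "\<forall>g\<in>N. (g, x0) \<in> D \<and> (g, xh0) \<in> D \<and> (g, u0) \<in> D' \<and>
      (ginv g, \<phi> g x0) \<in> D \<and> (ginv g, \<phi> g xh0) \<in> D \<and> (ginv g, \<psi> g u0) \<in> D'" .
  show ?thesis
  proof (rule exI[of _ N], intro conjI N(1,2) allI impI)
    fix c W \<gamma>
    assume frame: "moving_frame_on atlas \<phi> a c W \<gamma> \<and> W \<subseteq> X \<and> x0 \<in> W \<and> \<gamma> x0 \<in> N"
    then obtain M where M: "open M" "\<gamma> ` W \<subseteq> M"
      "\<forall>x\<in>W. \<forall>g\<in>M. comps a (\<phi> g x) = c \<longleftrightarrow> g = \<gamma> x"
      by (auto simp: moving_frame_on_def)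
    interpret framed_actions gmul e ginv atlas X D \<phi> a c W \<gamma> M U D' \<psi> \<beta>
    proof
      show "bij_betw \<beta> UNIV ((- range a) <+> UNIV)"
        by (rule assms(21))
    qed (use frame M inj in \<open>auto simp: moving_frame_on_def\<close>)
    have reg: "regular x0 u0" "(\<gamma> x0, xh0) \<in> D" "(ginv (\<gamma> x0), \<phi> (\<gamma> x0) xh0) \<in> D"
      using bspec[OF N(3), of "\<gamma> x0"] frame by (auto simp: regular_def)
    show "\<exists>V. (x0, u0) \<in> V \<and> V \<subseteq> X \<times> U \<and>
        full_rank_invariant_on e atlas \<phi> \<psi> V (frame_invariant \<phi> \<psi> \<gamma> \<beta>)"
      by (rule full_rank_frame_invariant[OF reg(1)])
    fix V and I :: "(real^'n) \<times> (real^'m) \<Rightarrow> real^'k"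
    assume I: "(x0, u0) \<in> V \<and> V \<subseteq> X \<times> U \<and> full_rank_invariant_on e atlas \<phi> \<psi> V I"
    show "autonomous_error_dynamics f h F (state_error \<phi> \<gamma>) I x0 xh0 u0"
      by (rule autonomous_error[OF assms(4-7,14,8,9,15,16) reg]) (use I in auto)
  qed
qed

end
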